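(* There exists $C\ge1$ such that for all $\alpha\in[0,1]$ and all $A\in\Omega$, $$C^{-1}|A|_\alpha\le|A|_{\mathrm{gr}\alpha}+|A|_\bullet\le C|A|_\alpha,$$ where $\bullet$ is any one of $\mathrm{vee}\,\alpha$, $\triangle\alpha$, or $\mathrm{symm}\,\alpha$.
   Context: $E$ is a Banach space; $\mathbf T^2=[-\frac12,\frac12)^2$ with geodesic distance. $\mathcal X=\mathbf T^2\times\{v\in\mathbb R^2:|v|\le\frac14\}$ (oriented segments); for $\ell=(x,v)$, $\ell_i=x$, $\ell_f=x+v$, $|\ell|=|v|$, $\iota(\ell)=\{x+cv:c\in[0,1)\}$. $\ell,\bar\ell$ are joinable if $\bar x=x+v$ and $v=cw,\bar v=\bar cw$ for a unit $w$, $c,\bar c\in[-\frac14,\frac14]$, $|c+\bar c|\le\frac14$; then $\ell\sqcup\bar\ell=(x,(c+\bar c)w)$. $\Omega$ is the space of measurable $A:\mathcal X\to E$ with $A(\ell\sqcup\bar\ell)=A(\ell)+A(\bar\ell)$ for joinable pairs. $\ell,\bar\ell$ are far if $|\ell_i-\bar\ell_i|\vee|\ell_f-\bar\ell_f|>\frac14(|\ell|\wedge|\bar\ell|)$. $\rho(\ell,\bar\ell)=|\ell|+|\bar\ell|$ if far, otherwise $|\ell_i-\bar\ell_i|+|\ell_f-\bar\ell_f|+\mathrm{Area}(\ell,\bar\ell)^{1/2}$, where $\mathrm{Area}(\ell,\bar\ell)$ is the area of the convex hull of $\ell_i,\ell_f,\bar\ell_f,\bar\ell_i$. $|A|_\alpha=\sup_{\rho(\ell,\bar\ell)>0}|A(\ell)-A(\bar\ell)|/\rho(\ell,\bar\ell)^\alpha$;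 $|A|_{\mathrm{gr}\alpha}=\sup_{|\ell|>0}|A(\ell)|/|\ell|^\alpha$. $\ell,\bar\ell$ form a vee if they are not far, $|\ell|=|\bar\ell|$ and $\ell_i=\bar\ell_i$; $|A|_{\mathrm{vee}\,\alpha}=\sup|A(\ell)-A(\bar\ell)|/\mathrm{Area}(\ell,\bar\ell)^{\alpha/2}$ over distinct pairs forming a vee. A triangle is $P=(\ell^1,\ell^2,\ell^3)\in\mathcal X^3$ with $\ell^1_i=\ell^3_f$, $\ell^j_i=\ell^{j-1}_f$ ($j=2,3$), the sets $\iota(\ell^j)$ pairwise disjoint and their union of diameter $\le\frac14$; $\mathring P$ is the simply connected component of its complement, $|P|$ the Lebesgue measure of $\mathring P$, and for triangles $P_1,P_2$, $|P_1;P_2|=|\mathring P_1\triangle\mathring P_2|$ if they have the same orientation and $|P_1|+|P_2|$ otherwise. $A(\partial P)=\sum_jA(\ell^j)$; $|A|_{\triangle\alpha}=\sup_{|P|>0}|A(\partial P)|/|P|^{\alpha/2}$ and $|A|_{\mathrm{symm}\,\alpha}=\sup_{|P;\bar P|>0}|A(\partial P)-A(\partial\bar P)|/|P;\bar P|^{\alpha/2}$, suprema over triangles. *)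

theory Defs
  imports "HOL-Analysis.Analysis"
begin

type_synonym pt = "real^2"
type_synonym seg = "pt \<times> pt"  \<comment> \<open>(x, v): initial point x and displacement v\<close>

text \<open>Torus T^2 = [-1/2,1/2)^2, realised as a box in R^2 with wrap-around map.\<close>

definition wrap1 :: "real \<Rightarrow> real" where
  "wrap1 t = t - of_int \<lfloor>t + 1/2\<rfloor>"

definition wrap :: "pt \<Rightarrow> pt" where
  "wrap x = (\<chi> i. wrap1 (x $ i))"

definition torus :: "pt set" where
  "torus = {x. \<forall>i. - 1/2 \<le> x $ i \<and> x $ i < 1/2}"

definition tdist :: "pt \<Rightarrow> pt \<Rightarrow> real" where
  "tdist x y = norm (wrap (x - y))"

definition Xsp :: "seg set" where
  "Xsp = {(x, v). x \<in> torus \<and> norm v \<le> 1/4}"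

definition seg_i :: "seg \<Rightarrow> pt" where "seg_i l = fst l"
definition seg_f :: "seg \<Rightarrow> pt" where "seg_f l = wrap (fst l + snd l)"
definition seg_len :: "seg \<Rightarrow> real" where "seg_len l = norm (snd l)"
definition iota :: "seg \<Rightarrow> pt set" where
  "iota l = (\<lambda>c. wrap (fst l + c *\<^sub>R snd l)) ` {0..<1}"

definition joinable :: "seg \<Rightarrow> seg \<Rightarrow> bool" where
  "joinable l l' \<longleftrightarrow> l \<in> Xsp \<and> l' \<in> Xsp \<and> fst l' = seg_f l \<and>
     (\<exists>w c c'. norm w = 1 \<and> snd l = c *\<^sub>R w \<and> snd l' = c' *\<^sub>R w \<and>
        c \<in> {-1/4..1/4} \<and> c' \<in> {-1/4..1/4} \<and> \<bar>c + c'\<bar> \<le> 1/4)"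

text \<open>For joinable pairs, (x,cw) \<squnion> (x',c'w) = (x,(c+c')w) = (x, v + v').\<close>
definition seg_join :: "seg \<Rightarrow> seg \<Rightarrow> seg" where
  "seg_join l l' = (fst l, snd l + snd l')"

definition Omega :: "(seg \<Rightarrow> 'e::banach) set" where
  "Omega = {A. A \<in> borel_measurable (restrict_space borel Xsp) \<and>
     (\<forall>l l'. joinable l l' \<longrightarrow> A (seg_join l l') = A l + A l')}"

definition far :: "seg \<Rightarrow> seg \<Rightarrow> bool" where
  "far l l' \<longleftrightarrow> max (tdist (seg_i l) (seg_i l')) (tdist (seg_f l) (seg_f l'))
      > (1/4) * min (seg_len l) (seg_len l')"

text \<open>Area of the convex hull of l_i, l_f, l'_f, l'_i (for pairs that are not far, which
  lie in a small ball of the torus; computed on the lift to R^2 where l'_i is the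
  representative closest to l_i).\<close>
definition seg_area :: "seg \<Rightarrow> seg \<Rightarrow> real" where
  "seg_area l l' = (let d = wrap (fst l' - fst l) in
     measure lebesgue (convex hull {0, snd l, d + snd l', d}))"

definition rho :: "seg \<Rightarrow> seg \<Rightarrow> real" where
  "rho l l' = (if far l l' then seg_len l + seg_len l'
     else tdist (seg_i l) (seg_i l') + tdist (seg_f l) (seg_f l') + sqrt (seg_area l l'))"

definition hol_norm :: "real \<Rightarrow> (seg \<Rightarrow> 'e::banach) \<Rightarrow> ennreal" where
  "hol_norm \<alpha> A = (SUP p \<in> {(l, l'). l \<in> Xsp \<and> l' \<in> Xsp \<and> rho l l' > 0}.
     ennreal (norm (A (fst p) - A (snd p)) / rho (fst p) (snd p) powr \<alpha>))"

definition gr_norm :: "real \<Rightarrow> (seg \<Rightarrow> 'e::banach) \<Rightarrow> ennreal" where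
  "gr_norm \<alpha> A = (SUP l \<in> {l. l \<in> Xsp \<and> seg_len l > 0}.
     ennreal (norm (A l) / seg_len l powr \<alpha>))"

definition is_vee :: "seg \<Rightarrow> seg \<Rightarrow> bool" where
  "is_vee l l' \<longleftrightarrow> \<not> far l l' \<and> seg_len l = seg_len l' \<and> seg_i l = seg_i l'"

definition vee_norm :: "real \<Rightarrow> (seg \<Rightarrow> 'e::banach) \<Rightarrow> ennreal" where
  "vee_norm \<alpha> A = (SUP p \<in> {(l, l'). l \<in> Xsp \<and> l' \<in> Xsp \<and> l \<noteq> l' \<and> is_vee l l'}.
     ennreal (norm (A (fst p) - A (snd p)) / seg_area (fst p) (snd p) powr (\<alpha> / 2)))"

type_synonym tri = "seg \<times> seg \<times> seg"

definition tri1 :: "tri \<Rightarrow> seg" where "tri1 P = fst P"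
definition tri2 :: "tri \<Rightarrow> seg" where "tri2 P = fst (snd P)"
definition tri3 :: "tri \<Rightarrow> seg" where "tri3 P = snd (snd P)"

definition triangle :: "tri \<Rightarrow> bool" where
  "triangle P \<longleftrightarrow> tri1 P \<in> Xsp \<and> tri2 P \<in> Xsp \<and> tri3 P \<in> Xsp \<and>
     seg_i (tri1 P) = seg_f (tri3 P) \<and> seg_i (tri2 P) = seg_f (tri1 P) \<and>
     seg_i (tri3 P) = seg_f (tri2 P) \<and>
     iota (tri1 P) \<inter> iota (tri2 P) = {} \<and> iota (tri1 P) \<inter> iota (tri3 P) = {} \<and>
     iota (tri2 P) \<inter> iota (tri3 P) = {} \<and>
     (\<forall>p \<in> iota (tri1 P) \<union> iota (tri2 P) \<union> iota (tri3 P).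
        \<forall>q \<in> iota (tri1 P) \<union> iota (tri2 P) \<union> iota (tri3 P). tdist p q \<le> 1/4)"

text \<open>Interior region of a triangle (the simply connected component of the complement
  of its boundary in T^2): the open triangle of the lift a, a+v1, a+v1+v2,
  projected back to the torus.\<close>
definition tri_int :: "tri \<Rightarrow> pt set" where
  "tri_int P = (let a = fst (tri1 P); v1 = snd (tri1 P); v2 = snd (tri2 P) in
     wrap ` interior (convex hull {a, a + v1, a + v1 + v2}))"

definition tri_area :: "tri \<Rightarrow> real" where
  "tri_area P = measure lebesgue (tri_int P)"

definition tri_orient :: "tri \<Rightarrow> real" where
  "tri_orient P = sgn (snd (tri1 P) $ 1 * snd (tri2 P) $ 2 - snd (tri1 P) $ 2 * snd (tri2 P) $ 1)"

definition tri_dist :: "tri \<Rightarrow> tri \<Rightarrow> real" where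
  "tri_dist P Q = (if tri_orient P = tri_orient Q
     then measure lebesgue ((tri_int P - tri_int Q) \<union> (tri_int Q - tri_int P))
     else tri_area P + tri_area Q)"

definition bdry :: "(seg \<Rightarrow> 'e::banach) \<Rightarrow> tri \<Rightarrow> 'e" where
  "bdry A P = A (tri1 P) + A (tri2 P) + A (tri3 P)"

definition tri_norm :: "real \<Rightarrow> (seg \<Rightarrow> 'e::banach) \<Rightarrow> ennreal" where
  "tri_norm \<alpha> A = (SUP P \<in> {P. triangle P \<and> tri_area P > 0}.
     ennreal (norm (bdry A P) / tri_area P powr (\<alpha> / 2)))"

definition symm_norm :: "real \<Rightarrow> (seg \<Rightarrow> 'e::banach) \<Rightarrow> ennreal" where
  "symm_norm \<alpha> A = (SUP p \<in> {(P, Q). triangle P \<and> triangle Q \<and> tri_dist P Q > 0}.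
     ennreal (norm (bdry A (fst p) - bdry A (snd p)) / tri_dist (fst p) (snd p) powr (\<alpha> / 2)))"

end

theory Submission
  imports Defs
begin

text \<open>
  Lift \<open>A\<close> to a function \<open>F p q\<close> of pairs of points of the plane at distance at most 1/4; it is
  antisymmetric and additive along lines. Both sides of each inequality are comparable with the least \<open>K\<close> for which
  \<open>\<parallel>F p q\<parallel> \<le> K * \<parallel>q - p\<parallel> powr \<alpha>\<close> and
  \<open>\<parallel>F p q - F p r\<parallel> \<le> K * (\<parallel>r - q\<parallel> + sqrt \<bar>det3 p q r\<bar>) powr \<alpha>\<close>: a pair of segments that is not far is
  halved, and each pair of halves is compared through a diagonal; a triangle is cut by the altitude onto its
  longest side.

  The delicate bound is that of the symm norm by \<open>K\<close>, for triangles \<open>T\<close>, \<open>T'\<close> whose symmetric difference has area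
  \<open>S\<close> much smaller than that of \<open>T\<close>. A homothety argument shows that the barycentric coordinates of the
  vertices of either triangle in terms of the other are at least \<open>- O(S / \<bar>T\<bar>)\<close>. These coordinates form two
  mutually inverse almost nonnegative matrices, hence are close to a permutation matrix, and by orientation the
  permutation is cyclic. Moving the vertices of \<open>T\<close> one at a time to the matching vertices of \<open>T'\<close> then
  sweeps out six triangles of area \<open>O(S)\<close>.
\<close>


subsection \<open>Wrapping the plane onto the torus\<close>

text \<open>The limit 1/4 on lengths shapes the argument, since \<open>F\<close> carries no
  information beyond it. The diagonal between two close segments of length 1/4 can already exceed
  it, and the vertices of two overlapping triangles can be 1/2 apart. Halving repairs both: a
  diagonal between half segments has length at most 1/16 + 1/8, and the medial subdivision of a
  triangle with sides up to 1/2 has sides up to 1/4. The second obstacle is the length term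
  \<open>norm (r - q)\<close> of the three-point bound, which the vee and triangle norms lack. The
  square root of an area has to absorb it: in a vee, because equal legs at a small angle enclose at
  least the order of the squared chord; in a triangle, because the altitude onto the longest side is
  at most that side.

  Correction: the entry above has a garbled last sentence. The list below is complete and replaces
  it.\<close>

lemma wrap1_less_half: "\<bar>t\<bar> < 1/2 \<Longrightarrow> wrap1 t = t"
  unfolding wrap1_def using floor_unique[of 0 "t + 1/2"] by (simp add: abs_less_iff)

lemma wrap1_bounds: "- 1/2 \<le> wrap1 t" "wrap1 t < 1/2"
  unfolding wrap1_def by linarith+

lemma abs_wrap1_le: "\<bar>wrap1 t\<bar> \<le> \<bar>t\<bar>"
proof (cases "\<bar>t\<bar> < 1/2")
  case False
  then show ?thesis using wrap1_bounds[of t] by linarith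
qed (simp add: wrap1_less_half)

lemma wrap1_eq_shift_iff:
  "wrap1 t = t - of_int m \<longleftrightarrow> of_int m - 1/2 \<le> t \<and> t < of_int m + 1/2"
proof -
  have "wrap1 t = t - of_int m \<longleftrightarrow> \<lfloor>t + 1/2\<rfloor> = m" by (auto simp: wrap1_def)
  then show ?thesis unfolding floor_eq_iff by linarith
qed

lemma wrap1_diff_Ints: "t - wrap1 t \<in> \<int>"
  by (simp add: wrap1_def)

lemma wrap1_eq_iff: "wrap1 s = wrap1 t \<longleftrightarrow> s - t \<in> \<int>"
proof
  assume "wrap1 s = wrap1 t"
  then have "s - t = (s - wrap1 s) - (t - wrap1 t)" by simp
  then show "s - t \<in> \<int>" by (metis Ints_diff wrap1_diff_Ints)
next
  assume "s - t \<in> \<int>"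
  then obtain k where k: "s = t + of_int k" by (metis Ints_cases add.commute diff_add_cancel)
  have "t + of_int k + 1/2 = (t + 1/2) + of_int k" by simp
  then have "\<lfloor>t + of_int k + 1/2\<rfloor> = \<lfloor>t + 1/2\<rfloor> + k" by (metis floor_add_int)
  then show "wrap1 s = wrap1 t" unfolding wrap1_def k by simp
qed

definition int_vec :: "pt \<Rightarrow> bool" where
  "int_vec k \<longleftrightarrow> (\<forall>i. k $ i \<in> \<int>)"

lemma int_vec_simps [simp]:
  "int_vec 0" "int_vec k \<Longrightarrow> int_vec (- k)"
  "int_vec k \<Longrightarrow> int_vec l \<Longrightarrow> int_vec (k + l)" "int_vec k \<Longrightarrow> int_vec l \<Longrightarrow> int_vec (k - l)"
  by (auto simp: int_vec_def)

lemma int_vec_small: "int_vec k \<Longrightarrow> norm k < 1 \<Longrightarrow> k = 0"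
proof -
  assume k: "int_vec k" "norm k < 1"
  have "k $ i = 0" for i
    using k component_le_norm_cart[of k i] Ints_nonzero_abs_less1[of "k $ i"]
    by (auto simp: int_vec_def)
  then show ?thesis by (simp add: vec_eq_iff)
qed

lemma wrap_eq_iff: "wrap x = wrap y \<longleftrightarrow> int_vec (x - y)"
  by (simp add: wrap_def vec_eq_iff wrap1_eq_iff int_vec_def)

lemma int_vec_wrap_diff: "int_vec (x - wrap x)"
  by (simp add: int_vec_def wrap_def wrap1_diff_Ints)

lemma wrap_small: "norm x < 1/2 \<Longrightarrow> wrap x = x"
  unfolding vec_eq_iff wrap_def
  by (metis component_le_norm_cart le_less_trans vec_lambda_beta wrap1_less_half)

lemma wrap_in_torus [simp]: "wrap x \<in> torus"
  using wrap1_bounds by (simp add: torus_def wrap_def)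

lemma wrap_torus: "x \<in> torus \<Longrightarrow> wrap x = x"
  using wrap1_eq_shift_iff[of _ 0] by (simp add: vec_eq_iff wrap_def torus_def)

lemma wrap_wrap_add [simp]: "wrap (wrap x + y) = wrap (x + y)"
proof -
  have "(wrap x + y) - (x + y) = - (x - wrap x)" by simp
  then show ?thesis by (metis int_vec_simps(2) int_vec_wrap_diff wrap_eq_iff)
qed

lemma wrap_wrap [simp]: "wrap (wrap x) = wrap x"
  using wrap_wrap_add[of x 0] by simp

lemma wrap_diff_wrap [simp]: "wrap (wrap x - wrap y) = wrap (x - y)"
proof -
  have "(wrap x - wrap y) - (x - y) = (y - wrap y) - (x - wrap x)" by simp
  then show ?thesis by (metis int_vec_simps(4) int_vec_wrap_diff wrap_eq_iff)
qed

lemma norm_wrap_le: "norm (wrap x) \<le> norm x"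
  by (rule norm_le_componentwise_cart) (simp add: wrap_def abs_wrap1_le)

text \<open>The difference is an integer vector of norm below 1, hence 0. This turns a small torus
  distance into a planar one.\<close>

lemma wrap_eq_self: "norm x + norm (wrap x) < 1 \<Longrightarrow> wrap x = x"
  using int_vec_small[OF int_vec_wrap_diff[of x]] norm_triangle_ineq4[of x "wrap x"] by simp

lemma tdist_wrap [simp]: "tdist (wrap x) (wrap y) = norm (wrap (x - y))"
  by (simp add: tdist_def)

lemma tdist_wrap_le: "tdist (wrap x) (wrap y) \<le> norm (x - y)"
  by (simp add: norm_wrap_le)

lemma inj_on_wrap: "(\<And>x y. x \<in> S \<Longrightarrow> y \<in> S \<Longrightarrow> norm (x - y) < 1) \<Longrightarrow> inj_on wrap S"
  unfolding inj_on_def wrap_eq_iff using int_vec_small by force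

text \<open>\<open>wrap\<close> translates each cell of the integer grid by a fixed vector, so it preserves
  the measure of a set on which it is injective.\<close>

lemma
  assumes S: "S \<in> sets lebesgue" and inj: "inj_on wrap S"
  shows sets_wrap_image: "wrap ` S \<in> sets lebesgue"
    and emeasure_wrap_image: "emeasure lebesgue (wrap ` S) = emeasure lebesgue S"
proof -
  define k :: "int \<times> int \<Rightarrow> pt" where "k = (\<lambda>(m, n). vector [of_int m, of_int n])"
  define C where "C p = {x. wrap x = x - k p}" for p
  have Ceq: "C p = {x. k p $ 1 - 1/2 \<le> x $ 1} \<inter> {x. x $ 1 < k p $ 1 + 1/2} \<inter>
      {x. k p $ 2 - 1/2 \<le> x $ 2} \<inter> {x. x $ 2 < k p $ 2 + 1/2}" for p
    by (cases p) (auto simp: C_def k_def wrap_def vec_eq_iff forall_2 wrap1_eq_shift_iff)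
  have Cs: "C p \<in> sets lebesgue" for p
  proof -
    have "C p \<in> sets borel"
      unfolding Ceq by (intro sets.Int borel_closed borel_open closed_Collect_le open_Collect_less
          continuous_intros)
    then show ?thesis by (simp add: sets_completionI_sets)
  qed
  have ex: "\<exists>p. x \<in> C p" for x
  proof -
    have "x $ 1 - wrap x $ 1 \<in> \<int>" "x $ 2 - wrap x $ 2 \<in> \<int>"
      using int_vec_wrap_diff[of x] by (auto simp: int_vec_def)
    then obtain m n where "x $ 1 - wrap x $ 1 = of_int m" "x $ 2 - wrap x $ 2 = of_int n"
      by (auto elim!: Ints_cases)
    then have "x \<in> C (m, n)" by (auto simp: C_def k_def vec_eq_iff forall_2)
    then show ?thesis by blast
  qed
  have injk: "k p = k q \<Longrightarrow> p = q" for p q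
    by (cases p; cases q) (auto simp: k_def vec_eq_iff forall_2)
  have dis: "x \<in> C p \<Longrightarrow> x \<in> C q \<Longrightarrow> p = q" for x p q
    using injk[of p q] by (auto simp: C_def)
  have US: "S = (\<Union>p\<in>UNIV. S \<inter> C p)" using ex by blast
  have UW: "wrap ` S = (\<Union>p\<in>UNIV. (\<lambda>x. - k p + x) ` (S \<inter> C p))"
  proof -
    have "wrap ` (S \<inter> C p) = (\<lambda>x. - k p + x) ` (S \<inter> C p)" for p
      by (intro image_cong) (auto simp: C_def)
    moreover have "wrap ` S = (\<Union>p\<in>UNIV. wrap ` (S \<inter> C p))" using ex by blast
    ultimately show ?thesis by simp
  qed
  show "wrap ` S \<in> sets lebesgue"
    unfolding UW by (intro sets.countable_UN' image_subsetI lebesgue_sets_translation sets.Int S Cs) simp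
  have "emeasure lebesgue (wrap ` S) =
      (\<integral>\<^sup>+p. emeasure lebesgue ((\<lambda>x. - k p + x) ` (S \<inter> C p)) \<partial>count_space UNIV)"
    unfolding UW
  proof (rule emeasure_UN_countable)
    show "disjoint_family_on (\<lambda>p. (\<lambda>x. - k p + x) ` (S \<inter> C p)) UNIV"
    proof -
      have "p = q" if "x \<in> S \<inter> C p" "y \<in> S \<inter> C q" "- k p + x = - k q + y" for p q x y
      proof -
        have "wrap x = wrap y" using that by (simp add: C_def)
        then have "x = y" using inj_onD[OF inj] that by blast
        then show ?thesis using dis[of x p q] that by blast
      qed
      then show ?thesis unfolding disjoint_family_on_def by blast
    qed
  qed (simp_all only: lebesgue_sets_translation sets.Int S Cs countableI_type)
  also have "\<dots> = (\<integral>\<^sup>+p. emeasure lebesgue (S \<inter> C p) \<partial>count_space UNIV)"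
    using emeasure_lebesgue_affine[of 1 "- k p" for p] by (simp add: add.commute)
  also have "\<dots> = emeasure lebesgue (\<Union>p\<in>UNIV. S \<inter> C p)"
    by (rule emeasure_UN_countable[symmetric])
      (use dis in \<open>auto intro!: sets.Int S Cs simp: disjoint_family_on_def\<close>)
  finally show "emeasure lebesgue (wrap ` S) = emeasure lebesgue S" using US by simp
qed

lemma measure_wrap_image:
  "S \<in> sets lebesgue \<Longrightarrow> inj_on wrap S \<Longrightarrow> measure lebesgue (wrap ` S) = measure lebesgue S"
  by (simp add: measure_def emeasure_wrap_image)

lemma lmeasurable_wrap_image:
  assumes S: "S \<in> lmeasurable" and inj: "inj_on wrap S"
  shows "wrap ` S \<in> lmeasurable"
proof (rule fmeasurableI)
  show "wrap ` S \<in> sets lebesgue" by (rule sets_wrap_image[OF fmeasurableD[OF S] inj])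
  show "emeasure lebesgue (wrap ` S) < \<infinity>"
    using S unfolding emeasure_wrap_image[OF fmeasurableD[OF S] inj] fmeasurable_def by blast
qed


subsection \<open>Triangles in the plane\<close>

definition cross2 :: "real^2 \<Rightarrow> real^2 \<Rightarrow> real" where
  "cross2 u v = u $ 1 * v $ 2 - u $ 2 * v $ 1"

definition det3 :: "real^2 \<Rightarrow> real^2 \<Rightarrow> real^2 \<Rightarrow> real" where
  "det3 p q r = cross2 (q - p) (r - p)"

lemmas det3_coord = det3_def cross2_def vector_minus_component vector_add_component
  vector_scaleR_component

lemma det3_rotate: "det3 q r p = det3 p q r" and det3_swap: "det3 p r q = - det3 p q r"
  by (simp_all add: det3_coord algebra_simps)

lemma measure_triangle: "measure lebesgue (convex hull {p, q, r}) = \<bar>det3 p q r\<bar> / 2"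
proof -
  have "(r $ 1 - p $ 1) * (q $ 2 - p $ 2) - (q $ 1 - p $ 1) * (r $ 2 - p $ 2) = - det3 p q r"
    by (simp add: det3_coord algebra_simps)
  then have "measure lborel (convex hull {p, q, r}) = \<bar>det3 p q r\<bar> / 2"
    by (simp add: content_triangle)
  moreover have "convex hull {p, q, r} \<in> sets lborel"
    by (simp add: borel_compact finite_imp_compact_convex_hull)
  ultimately show ?thesis by (simp add: measure_completion)
qed

lemma cross2_sq: "(cross2 u v)\<^sup>2 = (norm u)\<^sup>2 * (norm v)\<^sup>2 - (u \<bullet> v)\<^sup>2"
  unfolding power2_norm_eq_inner by (simp add: cross2_def inner_vec_def sum_2 power2_eq_square algebra_simps)

lemma triangle_sides_bound:
  fixes p :: "'a::real_inner"
  assumes "norm (p - q) \<le> r" "norm (q - s) \<le> r" "norm (s - p) \<le> r"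
    and "x \<in> convex hull {p, q, s}" "y \<in> convex hull {p, q, s}"
  shows "norm (x - y) \<le> r"
proof -
  obtain u v where "u \<in> {p, q, s}" "v \<in> {p, q, s}" "norm (x - y) \<le> norm (u - v)"
    using simplex_extremal_le_exists[of "{p, q, s}" x y] assms(4,5) by blast
  moreover have "0 \<le> r" using assms(1) norm_ge_zero order_trans by blast
  ultimately show ?thesis using assms(1-3) by (auto simp: norm_minus_commute)
qed

lemma measure_interior_hull:
  assumes "finite S"
  shows "measure lebesgue (interior (convex hull S)) = measure lebesgue (convex hull S)"
  using assms by (intro measure_interior negligible_convex_frontier convex_convex_hull)
    (simp_all add: finite_imp_bounded bounded_convex_hull)

lemma halfplane_convex: "convex {z. c \<le> det3 z q r}" "convex {z. det3 z q r \<le> c}"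
proof -
  have *: "det3 (u *\<^sub>R x + v *\<^sub>R y) q r = u * det3 x q r + v * det3 y q r" if "u + v = 1" for u v x y
  proof -
    have u: "u = 1 - v" using that by simp
    show ?thesis unfolding u by (simp add: det3_coord algebra_simps)
  qed
  have "c \<le> u * s + v * t" if "c \<le> s" "c \<le> t" "0 \<le> u" "0 \<le> v" "u + v = 1" for u v s t
    using convex_bound_le[of "- s" "- c" "- t" u v] that by simp
  then show "convex {z. c \<le> det3 z q r}"
    unfolding convex_def by (simp add: *)
  show "convex {z. det3 z q r \<le> c}"
    unfolding convex_def by (simp add: * convex_bound_le)
qed

text \<open>If \<open>x \<in> T'\<close> lay farther below the line \<open>qr\<close> than claimed, the homothety of ratio 1/2 centred at
  \<open>x\<close> would push out of \<open>T\<close> the part in \<open>T'\<close> of a thin subtriangle of \<open>T\<close> along \<open>qr\<close>.\<close>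

lemma det3_lower_bound:
  fixes p q r x :: "real^2"
  defines "T \<equiv> convex hull {p, q, r}"
  assumes T': "convex T'" "T' \<in> lmeasurable" and x: "x \<in> T'" and S: "S > 0"
    and 1: "measure lebesgue (T - T') \<le> S" and 2: "measure lebesgue (T' - T) \<le> S"
    and D: "12 * S \<le> det3 p q r"
  shows "det3 x q r \<ge> - (12 * S)"
proof (rule ccontr)
  assume neg: "\<not> ?thesis"
  \<comment> \<open>\<open>y\<close> is the point of the edge \<open>pq\<close> with
    \<open>det3 y q r\<close> equal to 12 S, so \<open>R\<close> has area 6 S. At least 5 S of it
    lies in \<open>T'\<close>, and the halved copy has area at least 5 S / 4, more than
    \<open>T' - T\<close> can hold.\<close>
  define \<eta> where "\<eta> = 12 * S / det3 p q r"
  have Dpos: "det3 p q r > 0" using S D by linarith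
  have \<eta>: "0 < \<eta>" "\<eta> \<le> 1" "\<eta> * det3 p q r = 12 * S"
    using S D Dpos by (auto simp: \<eta>_def)
  define y where "y = q + \<eta> *\<^sub>R (p - q)"
  define R where "R = convex hull {q, r, y}"
  define h where "h = (\<lambda>z. (1/2::real) *\<^sub>R z + (1/2) *\<^sub>R x)"
  have yD: "det3 y q r = 12 * S"
    using \<eta>(3) by (simp add: y_def det3_coord algebra_simps)
  have mR: "measure lebesgue R = 6 * S"
    unfolding R_def measure_triangle using yD S by (simp add: det3_rotate)
  have Tm: "T \<in> lmeasurable" "R \<in> lmeasurable"
    unfolding T_def R_def by (auto intro!: lmeasurable_compact finite_imp_compact_convex_hull)
  have "y = (1 - \<eta>) *\<^sub>R q + \<eta> *\<^sub>R p" by (simp add: y_def algebra_simps)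
  moreover have "p \<in> T" "q \<in> T" "r \<in> T" by (auto simp: T_def hull_inc)
  ultimately have "y \<in> T" using \<eta> convexD_alt[of T q p \<eta>] by (simp add: T_def convex_convex_hull)
  then have RT: "R \<subseteq> T"
    using \<open>q \<in> T\<close> \<open>r \<in> T\<close> unfolding R_def T_def by (intro hull_minimal) auto
  have Rlow: "det3 z q r \<le> 12 * S" if "z \<in> R" for z
  proof -
    have "R \<subseteq> {z. det3 z q r \<le> 12 * S}"
      unfolding R_def using S yD
      by (intro hull_minimal halfplane_convex) (auto simp: det3_coord)
    then show ?thesis using that by blast
  qed
  have Tpos: "det3 z q r \<ge> 0" if "z \<in> T" for z
  proof -
    have "T \<subseteq> {z. 0 \<le> det3 z q r}"
      unfolding T_def using Dpos by (intro hull_minimal halfplane_convex) (auto simp: det3_coord)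
    then show ?thesis using that by blast
  qed
  have sub: "h ` (R \<inter> T') \<subseteq> T' - T"
  proof
    fix w assume "w \<in> h ` (R \<inter> T')"
    then obtain z where z: "z \<in> R" "z \<in> T'" "w = h z" by blast
    have "w \<in> T'" using convexD[OF T'(1) z(2) x, of "1/2" "1/2"] by (simp add: z(3) h_def)
    moreover have "det3 w q r = (det3 z q r + det3 x q r) / 2"
      by (simp add: z(3) h_def det3_coord algebra_simps)
    then have "det3 w q r < 0" using Rlow[OF z(1)] neg by simp
    ultimately show "w \<in> T' - T" using Tpos[of w] by auto
  qed
  have "6 * S = measure lebesgue (R \<inter> T') + measure lebesgue (R - T')"
    using measure_Un2[of "R \<inter> T'" lebesgue R] Tm T' mR
    by (simp add: fmeasurable.Int Un_absorb1 Diff_Int_distrib Diff_Int)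
  moreover have "measure lebesgue (R - T') \<le> measure lebesgue (T - T')"
    by (rule measure_mono_fmeasurable) (use RT Tm T' in \<open>auto intro: fmeasurable_Diff fmeasurableD\<close>)
  ultimately have "5 * S \<le> measure lebesgue (R \<inter> T')" using 1 by linarith
  moreover have "measure lebesgue (h ` (R \<inter> T')) = measure lebesgue (R \<inter> T') / 4"
    using measure_lebesgue_affine[of "1/2" "(1/2) *\<^sub>R x" "R \<inter> T'"]
    by (simp add: h_def power2_eq_square)
  moreover have "measure lebesgue (h ` (R \<inter> T')) \<le> measure lebesgue (T' - T)"
  proof (rule measure_mono_fmeasurable[OF sub])
    have "h ` (R \<inter> T') = (\<lambda>z. (1/2) *\<^sub>R x + z) ` ((*\<^sub>R) (1/2) ` (R \<inter> T'))"
      by (auto simp: h_def image_image add.commute)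
    moreover have "(*\<^sub>R) (1/2) ` (R \<inter> T') \<in> lmeasurable"
      by (intro measurable_linear_image fmeasurable.Int Tm T' bounded_linear.linear bounded_linear_scaleR_right)
    ultimately show "h ` (R \<inter> T') \<in> sets lebesgue"
      by (metis fmeasurableD measurable_translation)
  qed (use Tm T' in \<open>auto intro: fmeasurable_Diff fmeasurableD\<close>)
  ultimately show False using 2 S by linarith
qed

text \<open>A nonnegative matrix with nonnegative inverse is monomial; this is the perturbative version for
  column-stochastic matrices.\<close>

lemma near_permutation:
  fixes M N :: "3 \<Rightarrow> 3 \<Rightarrow> real"
  assumes inv: "\<And>i k. (\<Sum>j\<in>UNIV. M i j * N j k) = (if i = k then 1 else 0)"
    and cM: "\<And>j. (\<Sum>i\<in>UNIV. M i j) = 1" and cN: "\<And>j. (\<Sum>i\<in>UNIV. N i j) = 1"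
    and lM: "\<And>i j. - \<delta> \<le> M i j" and lN: "\<And>i j. - \<delta> \<le> N i j"
    and \<delta>: "0 \<le> \<delta>" "\<delta> \<le> 1/100"
  shows "\<exists>\<sigma>. inj \<sigma> \<and> (\<forall>i k. k \<noteq> i \<longrightarrow> \<bar>M k (\<sigma> i)\<bar> \<le> 9 * \<delta>)"
proof -
  have up: "B i j \<le> 1 + 2 * \<delta>" if "\<And>j. (\<Sum>i\<in>UNIV. B i j) = 1" "\<And>i j. - \<delta> \<le> B i j"
    for B :: "3 \<Rightarrow> 3 \<Rightarrow> real" and i j
    using that(1)[of j] that(2)[of 1 j] that(2)[of 2 j] that(2)[of 3 j] exhaust_3[of i]
    by (auto simp: sum_3)
  note uM = up[of M, OF cM lM] and uN = up[of N, OF cN lN]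
  have d2: "\<delta> * (1 + 2 * \<delta>) \<le> (102/100) * \<delta>"
    using mult_left_mono[of "1 + 2 * \<delta>" "102/100" \<delta>] \<delta> by (simp add: mult.commute)
  have low: "- (\<delta> * (1 + 2 * \<delta>)) \<le> x * y"
    if "- \<delta> \<le> x" "- \<delta> \<le> y" "x \<le> 1 + 2 * \<delta>" "y \<le> 1 + 2 * \<delta>" for x y
  proof -
    consider "0 \<le> x * y" | "x < 0" "0 \<le> y" | "0 \<le> x" "y < 0"
      by (metis mult_nonneg_nonneg mult_nonpos_nonpos not_le less_imp_le)
    then show ?thesis
    proof cases
      case 1
      then show ?thesis using \<delta> by (smt (verit) mult_nonneg_nonneg)
    next
      case 2
      then show ?thesis using mult_mono[of "- x" \<delta> y "1 + 2 * \<delta>"] that \<delta> by simp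
    next
      case 3
      then show ?thesis using mult_mono[of "- y" \<delta> x "1 + 2 * \<delta>"] that \<delta>
        by (simp add: mult.commute)
    qed
  qed
  have ex: "\<exists>j. \<forall>k. k \<noteq> i \<longrightarrow> \<bar>M k j\<bar> \<le> 9 * \<delta>" for i
  proof -
    \<comment> \<open>The diagonal entry 1 of the product matrix has three summands, so one is at
      least 1/3. Entries of \<open>M\<close> are at most 1 + 2 \<delta>, which forces the factor
      from \<open>N\<close> to be at least 1/4.\<close>
    have "\<exists>j. 1/3 \<le> M i j * N j i"
    proof (rule ccontr)
      assume "\<not> ?thesis"
      then have "M i j * N j i < 1/3" for j by (simp add: not_le)
      from this[of 1] this[of 2] this[of 3] show False using inv[of i i] by (simp add: sum_3)
    qed
    then obtain j where j: "1/3 \<le> M i j * N j i" by blast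
    have N4: "1/4 \<le> N j i"
    proof (rule ccontr)
      assume n: "\<not> ?thesis"
      consider "M i j * N j i \<le> 0" | "0 < M i j" "0 < N j i" | "M i j < 0" "N j i < 0"
        by (meson mult_nonneg_nonpos mult_nonpos_nonneg not_le less_imp_le)
      then show False
      proof cases
        case 2
        then have "M i j * N j i \<le> (1 + 2 * \<delta>) * (1/4)"
          using n uM[of i j] \<delta> by (intro mult_mono) auto
        then show ?thesis using j \<delta> by simp
      next
        case 3
        then have "(- M i j) * (- N j i) \<le> \<delta> * 1"
          using lM[of i j] lN[of j i] \<delta> by (intro mult_mono) auto
        then show ?thesis using j \<delta> by simp
      qed (use j in simp)
    qed
    \<comment> \<open>The off-diagonal entry vanishes and its other two summands are almost
      nonnegative, so this one is at most 2.04 \<delta>; dividing by \<open>N j i\<close>, at least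
      1/4, stays below 9 \<delta>.\<close>
    have "\<bar>M k j\<bar> \<le> 9 * \<delta>" if "k \<noteq> i" for k
    proof -
      have l: "- (102/100 * \<delta>) \<le> M k m * N m i" for m
        using low[OF lM lN uM uN, of k m m i] d2 by linarith
      have "M k 1 * N 1 i + M k 2 * N 2 i + M k 3 * N 3 i = 0"
        using inv[of k i] that by (simp add: sum_3)
      then have s: "M k j * N j i \<le> 2 * (102/100 * \<delta>)"
        using l[of 1] l[of 2] l[of 3] exhaust_3[of j] by auto
      have "M k j \<le> 9 * \<delta>"
      proof (rule ccontr)
        assume "\<not> ?thesis"
        then have "M k j * (1/4) \<le> M k j * N j i" "9 * \<delta> < M k j"
          using N4 \<delta> by (auto intro!: mult_left_mono)
        then show False using s \<delta> by linarith
      qed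
      then show ?thesis using lM[of k j] \<delta> by linarith
    qed
    then show ?thesis by blast
  qed
  then obtain \<sigma> where \<sigma>: "\<And>i k. k \<noteq> i \<Longrightarrow> \<bar>M k (\<sigma> i)\<bar> \<le> 9 * \<delta>" by metis
  have "inj \<sigma>"
  proof (rule injI, rule ccontr)
    \<comment> \<open>A column chosen twice would have all three entries at most 9 \<delta> and
      could not sum to 1.\<close>
    fix i i' assume e: "\<sigma> i = \<sigma> i'" "i \<noteq> i'"
    have "M k (\<sigma> i) \<le> 9 * \<delta>" for k
      using \<sigma>[of k i] \<sigma>[of k i'] e by (cases "k = i") (auto simp: abs_le_iff)
    from this[of 1] this[of 2] this[of 3] show False using cM[of "\<sigma> i"] \<delta> by (simp add: sum_3)
  qed
  then show ?thesis using \<sigma> by blast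
qed

section \<open>Barycentric coordinates and the matching of vertices\<close>

text \<open>Cramer's rule without division: \<open>x\<close> is written in barycentric coordinates
  of the triangle \<open>p b c\<close>, and the affine function \<open>det3 _ q r\<close> is
  evaluated on both sides.\<close>

lemma det3_expand:
  "det3 p q r * det3 x b c + det3 b q r * det3 p x c + det3 c q r * det3 p b x
    = det3 x q r * det3 p b c"
  by (simp add: det3_coord algebra_simps)

text \<open>The barycentric coordinates by Cramer's rule. Indexing by the type \<open>3\<close>
  makes the coordinates of one triangle's vertices in another a matrix.\<close>

definition bary :: "(3 \<Rightarrow> real^2) \<Rightarrow> 3 \<Rightarrow> real^2 \<Rightarrow> real" where
  "bary P i x = det3 (if i = 1 then x else P 1) (if i = 2 then x else P 2) (if i = 3 then x else P 3)
     / det3 (P 1) (P 2) (P 3)"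

lemma bary_sum: "det3 (P 1) (P 2) (P 3) \<noteq> 0 \<Longrightarrow> (\<Sum>i\<in>UNIV. bary P i x) = 1"
proof -
  have "det3 x (P 2) (P 3) + det3 (P 1) x (P 3) + det3 (P 1) (P 2) x = det3 (P 1) (P 2) (P 3)"
    by (simp add: det3_coord algebra_simps)
  then show "det3 (P 1) (P 2) (P 3) \<noteq> 0 \<Longrightarrow> ?thesis"
    by (simp add: sum_3 bary_def add_divide_distrib[symmetric])
qed

lemma bary_self: "det3 (P 1) (P 2) (P 3) \<noteq> 0 \<Longrightarrow> bary P i (P k) = (if i = k then 1 else 0)"
proof -
  have "det3 x x y = 0" "det3 y x x = 0" "det3 x y x = 0" for x y
    by (simp_all add: det3_coord)
  then show "det3 (P 1) (P 2) (P 3) \<noteq> 0 \<Longrightarrow> ?thesis"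
    using exhaust_3[of i] exhaust_3[of k] by (auto simp: bary_def)
qed

text \<open>A barycentric coordinate is affine, so it commutes with writing \<open>x\<close> as an
  affine combination of the vertices of \<open>Q\<close>. At \<open>x = P k\<close> this says that
  the two coordinate matrices are inverse.\<close>

lemma bary_comp:
  assumes "det3 (Q 1) (Q 2) (Q 3) \<noteq> 0"
  shows "(\<Sum>j\<in>UNIV. bary P i (Q j) * bary Q j x) = bary P i x"
proof -
  have "det3 (Q 1) q r * det3 x (Q 2) (Q 3) + det3 (Q 2) q r * det3 (Q 1) x (Q 3)
      + det3 (Q 3) q r * det3 (Q 1) (Q 2) x = det3 x q r * det3 (Q 1) (Q 2) (Q 3)" for q r
    using det3_expand[of "Q 1" q r x "Q 2" "Q 3"] by simp
  then have e: "(\<Sum>j\<in>UNIV. det3 (Q j) q r * bary Q j x) = det3 x q r" for q r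
    using assms by (simp add: bary_def sum_3 add_divide_distrib[symmetric])
  have "\<exists>q r. \<forall>y. bary P i y = det3 y q r / det3 (P 1) (P 2) (P 3)"
  proof -
    consider "i = 1" | "i = 2" | "i = 3" using exhaust_3[of i] by blast
    then show ?thesis
    proof cases
      case 1
      then show ?thesis by (auto simp: bary_def)
    next
      case 2
      then have "bary P i y = det3 y (P 3) (P 1) / det3 (P 1) (P 2) (P 3)" for y
        using det3_rotate[of y "P 3" "P 1"] by (simp add: bary_def)
      then show ?thesis by blast
    next
      case 3
      then have "bary P i y = det3 y (P 1) (P 2) / det3 (P 1) (P 2) (P 3)" for y
        using det3_rotate[of "P 1" "P 2" y] by (simp add: bary_def)
      then show ?thesis by blast
    qed
  qed
  then obtain q r where "\<And>y. bary P i y = det3 y q r / det3 (P 1) (P 2) (P 3)" by blast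
  then show ?thesis using e[of q r] by (simp add: sum_divide_distrib[symmetric])
qed

lemma det3_lower_bounds:
  fixes p q r x :: "real^2"
  defines "T \<equiv> convex hull {p, q, r}"
  assumes "convex T'" "T' \<in> lmeasurable" "x \<in> T'" "S > 0"
    "measure lebesgue (T - T') \<le> S" "measure lebesgue (T' - T) \<le> S" "12 * S \<le> det3 p q r"
  shows "- (12 * S) \<le> det3 x q r" "- (12 * S) \<le> det3 p x r" "- (12 * S) \<le> det3 p q x"
proof -
  have T: "T = convex hull {q, r, p}" "T = convex hull {r, p, q}"
    unfolding T_def by (simp_all add: insert_commute)
  have D: "12 * S \<le> det3 q r p" "12 * S \<le> det3 r p q"
    using assms(8) det3_rotate by metis+
  show "- (12 * S) \<le> det3 x q r" using assms det3_lower_bound[of T' x S p q r] by simp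
  have "- (12 * S) \<le> det3 x r p"
    by (rule det3_lower_bound[of T' x S q r p, folded T(1)]) (use assms D in simp_all)
  then show "- (12 * S) \<le> det3 p x r" using det3_rotate[of x r p] by simp
  have "- (12 * S) \<le> det3 x p q"
    by (rule det3_lower_bound[of T' x S r p q, folded T(2)]) (use assms D in simp_all)
  then show "- (12 * S) \<le> det3 p q x" using det3_rotate[of p q x] by simp
qed

text \<open>The six determinants belong to the triangles swept out in \<open>loop_diff\<close>.
  Three are off-diagonal barycentric coordinates scaled by \<open>det3 a b c\<close>; each of the
  others is a sum of two products of such a small coordinate with a bounded one.\<close>

lemma close_triangles_match:
  fixes a b c a' b' c' :: "real^2"
  defines "T \<equiv> convex hull {a, b, c}" and "T' \<equiv> convex hull {a', b', c'}"
  assumes D: "0 < det3 a b c" "0 < det3 a' b' c'" and S: "0 < S" "4000 * S \<le> det3 a b c"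
    and m: "measure lebesgue (T - T') \<le> S" "measure lebesgue (T' - T) \<le> S"
  shows "\<exists>a'' b'' c''. (a'', b'', c'') \<in> {(a', b', c'), (b', c', a'), (c', a', b')} \<and>
    \<bar>det3 a b a''\<bar> \<le> 648 * S \<and> \<bar>det3 c a a''\<bar> \<le> 648 * S \<and>
    \<bar>det3 b c b''\<bar> \<le> 648 * S \<and> \<bar>det3 a'' b b''\<bar> \<le> 648 * S \<and>
    \<bar>det3 c a'' c''\<bar> \<le> 648 * S \<and> \<bar>det3 b'' c c''\<bar> \<le> 648 * S"
proof -
  define P where "P = (\<lambda>i::3. if i = 1 then a else if i = 2 then b else c)"
  define P' where "P' = (\<lambda>i::3. if i = 1 then a' else if i = 2 then b' else c')"
  have P: "P 1 = a" "P 2 = b" "P 3 = c" "P' 1 = a'" "P' 2 = b'" "P' 3 = c'"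
    by (simp_all add: P_def P'_def)
  define d d' where "d = det3 a b c" and "d' = det3 a' b' c'"
  have d: "0 < d" "0 < d'" "4000 * S \<le> d" using D S by (simp_all add: d_def d'_def)
  have T: "convex T" "T \<in> lmeasurable" "convex T'" "T' \<in> lmeasurable"
    unfolding T_def T'_def
    by (auto intro!: lmeasurable_compact finite_imp_compact_convex_hull)
  have PT: "P i \<in> T" "P' i \<in> T'" for i
    using exhaust_3[of i] by (auto simp: P T_def T'_def hull_inc)
  have mT: "measure lebesgue T = d / 2" "measure lebesgue T' = d' / 2"
    using d by (simp_all add: T_def T'_def measure_triangle d_def d'_def)
  have "measure lebesgue (T' \<union> T) = measure lebesgue T' + measure lebesgue (T - T')"
    using measure_Un2[of T' lebesgue T] T by simp
  moreover have "measure lebesgue T \<le> measure lebesgue (T' \<union> T)"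
    using T by (intro measure_mono_fmeasurable) (auto intro: fmeasurable.Un)
  ultimately have d'2: "d / 2 \<le> d'" using m mT d by linarith
  \<comment> \<open>Coordinates in \<open>T\<close> are at least -12 S / d, those in
    \<open>T'\<close> at least -12 S / d'. Since d' is at least d / 2, the value 24 S / d serves
    both.\<close>
  define \<delta> where "\<delta> = 24 * S / d"
  have \<delta>: "0 \<le> \<delta>" "\<delta> \<le> 1/100" "\<delta> * d = 24 * S" using d S by (auto simp: \<delta>_def)
  have "- (12 * S) \<le> bary P i (P' j) * d" for i j
    using det3_lower_bounds[of T' "P' j" S a b c, OF T(3,4) PT(2)] S m d exhaust_3[of i]
    by (auto simp: bary_def P T_def d_def)
  then have "- (12 * S) / d \<le> bary P i (P' j)" for i j using pos_divide_le_eq[OF d(1)] by blast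
  moreover have "- \<delta> \<le> - (12 * S) / d" using d S by (simp add: \<delta>_def divide_right_mono)
  ultimately have lM: "- \<delta> \<le> bary P i (P' j)" for i j by (meson order_trans)
  have "- (12 * S) \<le> bary P' i (P j) * d'" for i j
    using det3_lower_bounds[of T "P j" S a' b' c', OF T(1,2) PT(1)] S m d d'2 exhaust_3[of i]
    by (auto simp: bary_def P T'_def d'_def)
  then have "- (12 * S) / d' \<le> bary P' i (P j)" for i j using pos_divide_le_eq[OF d(2)] by blast
  moreover have "- \<delta> \<le> - (12 * S) / d'" using d d'2 S by (simp add: \<delta>_def field_simps)
  ultimately have lN: "- \<delta> \<le> bary P' i (P j)" for i j by (meson order_trans)
  have ne: "det3 (P 1) (P 2) (P 3) \<noteq> 0" "det3 (P' 1) (P' 2) (P' 3) \<noteq> 0" using D by (simp_all add: P)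
  obtain \<sigma> where \<sigma>: "inj \<sigma>" "\<And>i k. k \<noteq> i \<Longrightarrow> \<bar>bary P k (P' (\<sigma> i))\<bar> \<le> 9 * \<delta>"
    using near_permutation[of "\<lambda>i j. bary P i (P' j)" "\<lambda>j k. bary P' j (P k)" \<delta>]
      bary_comp[OF ne(2), of P] bary_self[OF ne(1)] bary_sum[OF ne(1)] bary_sum[OF ne(2)] lM lN \<delta>
    by auto
  define q r s where "q = P' (\<sigma> 1)" and "r = P' (\<sigma> 2)" and "s = P' (\<sigma> 3)"
  \<comment> \<open>216 = 9 * 24, with the 9 from \<open>near_permutation\<close>; the final 648 is
    216 * 2 + 216.\<close>
  have small: "\<bar>x\<bar> \<le> 216 * S" if "\<bar>x / d\<bar> \<le> 9 * \<delta>" for x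
  proof -
    have "\<bar>x\<bar> \<le> 9 * \<delta> * d" using that d by (simp add: abs_divide field_simps)
    then show ?thesis using \<delta>(3) by simp
  qed
  have sm: "\<bar>det3 a q c\<bar> \<le> 216 * S" "\<bar>det3 a b q\<bar> \<le> 216 * S" "\<bar>det3 r b c\<bar> \<le> 216 * S"
    "\<bar>det3 a b r\<bar> \<le> 216 * S" "\<bar>det3 s b c\<bar> \<le> 216 * S" "\<bar>det3 a s c\<bar> \<le> 216 * S"
    using \<sigma>(2)[of 2 1] \<sigma>(2)[of 3 1] \<sigma>(2)[of 1 2] \<sigma>(2)[of 3 2] \<sigma>(2)[of 1 3] \<sigma>(2)[of 2 3]
    by (auto intro!: small simp: bary_def P q_def r_def s_def d_def)
  have sum: "det3 x b c + det3 a x c + det3 a b x = d" for x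
    unfolding d_def by (simp add: det3_coord algebra_simps)
  have big: "\<bar>det3 q b c\<bar> \<le> 2 * d" "\<bar>det3 a r c\<bar> \<le> 2 * d"
    using sum[of q] sum[of r] sm(1-4) d S by linarith+
  have prod: "\<bar>u\<bar> \<le> 648 * S" if "u * d = x * y + z * w" "\<bar>x\<bar> \<le> 216 * S" "\<bar>z\<bar> \<le> 216 * S"
    "\<bar>y\<bar> \<le> 2 * d" "\<bar>w\<bar> \<le> d" for u x y z w
  proof -
    have "\<bar>u\<bar> * d = \<bar>x * y + z * w\<bar>" using that(1) d by (metis abs_mult abs_of_pos)
    also have "\<dots> \<le> \<bar>x\<bar> * \<bar>y\<bar> + \<bar>z\<bar> * \<bar>w\<bar>" by (metis abs_mult abs_triangle_ineq)
    also have "\<dots> \<le> (216 * S) * (2 * d) + (216 * S) * d"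
      using that d S by (intro add_mono mult_mono) auto
    finally have "\<bar>u\<bar> * d \<le> (648 * S) * d" by (simp add: algebra_simps)
    then show ?thesis using d by (simp add: mult_le_cancel_right)
  qed
  have sm': "\<bar>x\<bar> \<le> d" if "\<bar>x\<bar> \<le> 216 * S" for x using that d S by linarith
  have flip: "det3 c b x = - det3 x b c" "det3 b x c = - det3 x b c" "det3 a c x = - det3 a x c"
    "det3 b c x = det3 x b c" for x
    by (simp_all add: det3_coord algebra_simps)
  have z: "det3 x x y = 0" "det3 y x x = 0" "det3 x y x = 0" for x y
    by (simp_all add: det3_coord)
  \<comment> \<open>In the expansion one of the three products has a repeated vertex and vanishes;
    each remaining product has a factor of size at most 216 S.\<close>
  have "det3 q b r * d = det3 a b r * det3 q b c + (- det3 r b c) * det3 a b q"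
    using det3_expand[of a b r q b c, unfolded z flip(1)[of r]]
    by (simp only: d_def mult_zero_left add_0_right)
  then have 4: "\<bar>det3 q b r\<bar> \<le> 648 * S" by (rule prod) (simp_all only: abs_minus_cancel sm sm' big)
  have "det3 c q s * d = det3 a s c * det3 q b c + (- det3 s b c) * det3 a q c"
    using det3_expand[of a s c q b c, unfolded z flip(2)[of s] det3_rotate[of q s c]]
    by (simp only: d_def mult_zero_left add_0_right)
  then have 5: "\<bar>det3 c q s\<bar> \<le> 648 * S" by (rule prod) (simp_all only: abs_minus_cancel sm sm' big)
  have "det3 r c s * d = det3 s b c * det3 a r c + (- det3 a s c) * det3 r b c"
    using det3_expand[of a c s r b c, unfolded z flip(3,4)[of s]]
    by (simp only: d_def mult_zero_left add_0_right mult.commute add.commute)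
  then have 6: "\<bar>det3 r c s\<bar> \<le> 648 * S" by (rule prod) (simp_all only: abs_minus_cancel sm sm' big)
  \<comment> \<open>This is \<open>loop_diff\<close> for the signed area. The right side is at most
    3 * 216 S + 3 * 648 S = 2592 S, below 4000 S, so \<open>q r s\<close> is positively oriented and
    the matching cannot be a transposition.\<close>
  have "d - det3 q r s = det3 a b q + det3 a q c + det3 r b c + det3 q b r + det3 c q s + det3 r c s"
    unfolding d_def by (simp add: det3_coord algebra_simps)
  then have pos: "0 < det3 q r s"
    using sm(1-3)[THEN abs_le_D1] 4[THEN abs_le_D1] 5[THEN abs_le_D1] 6[THEN abs_le_D1] d S
    by linarith
  have "(q, r, s) \<in> {(a', b', c'), (b', c', a'), (c', a', b')}"
  proof -
    have "\<sigma> 1 \<noteq> \<sigma> 2" "\<sigma> 1 \<noteq> \<sigma> 3" "\<sigma> 2 \<noteq> \<sigma> 3" by (simp_all add: inj_eq[OF \<sigma>(1)])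
    moreover have "det3 a' c' b' < 0" "det3 b' a' c' < 0" "det3 c' b' a' < 0"
      using D(2) by (simp_all add: det3_coord algebra_simps)
    then have "(\<sigma> 1, \<sigma> 2, \<sigma> 3) \<notin> {(1, 3, 2), (2, 1, 3), (3, 2, 1)}"
      using pos by (auto simp: q_def r_def s_def P)
    ultimately have "(\<sigma> 1, \<sigma> 2, \<sigma> 3) \<in> {(1, 2, 3), (2, 3, 1), (3, 1, 2)}"
      using exhaust_3[of "\<sigma> 1"] exhaust_3[of "\<sigma> 2"] exhaust_3[of "\<sigma> 3"]
      by (elim disjE) simp_all
    then show ?thesis by (auto simp: q_def r_def s_def P)
  qed
  moreover have "det3 b c r = det3 r b c" "det3 c a q = det3 a q c"
    by (simp_all add: det3_coord algebra_simps)
  moreover have "\<bar>x\<bar> \<le> 648 * S" if "\<bar>x\<bar> \<le> 216 * S" for x using that S by linarith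
  ultimately show ?thesis
    using sm(1-3) 4 5 6 by (intro exI[of _ q] exI[of _ r] exI[of _ s]) simp
qed


subsection \<open>Boundary sums of nearby triangles\<close>

text \<open>Exponents at most 1 let a constant leave the power as itself, which keeps all constants
  independent of \<alpha>.\<close>

lemma powr_scale_le:
  fixes x C \<beta> :: real
  assumes "0 \<le> x" "1 \<le> C" "0 \<le> \<beta>" "\<beta> \<le> 1"
  shows "(C * x) powr \<beta> \<le> C * x powr \<beta>"
proof -
  have "C powr \<beta> \<le> C powr 1" using assms by (intro powr_mono) auto
  then show ?thesis using assms by (simp add: powr_mult mult_right_mono)
qed

text \<open>\<open>tri_int\<close> comes from open triangles, while the matching concerns closed
  hulls; the frontier of a convex set is negligible.\<close>

lemma measure_Diff_interior_le:
  fixes S T :: "'a::euclidean_space set"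
  assumes "convex S" "compact S" "compact T"
  shows "measure lebesgue (S - T) \<le> measure lebesgue (interior S - interior T)"
proof -
  have m: "interior S - interior T \<in> lmeasurable"
    using assms by (intro fmeasurable_Diff lmeasurable_interior) (auto simp: compact_imp_bounded)
  note f = negligible_convex_frontier[OF assms(1), THEN negligible_imp_measurable]
    negligible_convex_frontier[OF assms(1), THEN negligible_imp_measure0]
  have "S - T \<subseteq> (interior S - interior T) \<union> frontier S"
    using interior_subset[of T] closure_subset[of S] by (auto simp: frontier_def)
  then have "measure lebesgue (S - T) \<le> measure lebesgue ((interior S - interior T) \<union> frontier S)"
    using assms m f(1) by (intro measure_mono_fmeasurable)
      (auto intro: fmeasurable.Un fmeasurable_Diff lmeasurable_compact fmeasurableD)
  also have "\<dots> \<le> measure lebesgue (interior S - interior T) + measure lebesgue (frontier S)"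
    using m f(1) by (intro measure_Un_le) auto
  finally show ?thesis using f by simp
qed

definition loop :: "('p \<Rightarrow> 'p \<Rightarrow> 'e::ab_group_add) \<Rightarrow> 'p \<Rightarrow> 'p \<Rightarrow> 'p \<Rightarrow> 'e" where
  "loop F p q r = F p q + F q r + F r p"

lemma loop_rotate: "loop F q r p = loop F p q r"
  by (simp add: loop_def ac_simps)

lemma loop_swap: "(\<And>p q. F q p = - F p q) \<Longrightarrow> loop F p r q = - loop F p q r"
  unfolding loop_def by (metis add.commute add.left_commute minus_add_distrib)

text \<open>The vertices are moved one at a time; each move sweeps out two triangles.\<close>

lemma loop_diff:
  assumes "\<And>p q. F q p = - F p q"
  shows "loop F a b c - loop F a' b' c' = loop F a b a' + loop F c a a' + loop F b c b' +
    loop F a' b b' + loop F c a' c' + loop F b' c c'"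
  using assms[of a b] assms[of b c] assms[of c a] assms[of a' b'] assms[of b' c'] assms[of c' a']
    assms[of a a'] assms[of b b'] assms[of c c'] assms[of a' b] assms[of a' c] assms[of b' c]
  unfolding loop_def by (simp add: algebra_simps)

text \<open>For S small against the first triangle, the six swept triangles cost 6 * 648 = 3888.
  Otherwise both determinants are at most 4002 S and the loops are bounded separately, at cost 8004.
  The bound on loops is asked only on \<open>V\<close> because it is available only for points close
  together.\<close>

lemma loop_symm_bound_pos:
  fixes F :: "real^2 \<Rightarrow> real^2 \<Rightarrow> 'e::real_normed_vector"
  assumes anti: "\<And>p q. F q p = - F p q" and K: "0 \<le> K" "0 \<le> \<beta>" "\<beta> \<le> 1"
    and bd: "\<And>x y z. x \<in> V \<Longrightarrow> y \<in> V \<Longrightarrow> z \<in> V \<Longrightarrow> norm (loop F x y z) \<le> K * \<bar>det3 x y z\<bar> powr \<beta>"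
    and V: "{a, b, c, a', b', c'} \<subseteq> V"
    and D: "0 < det3 a b c" "0 < det3 a' b' c'" and S: "0 < S"
    and m: "measure lebesgue (convex hull {a, b, c} - convex hull {a', b', c'}) \<le> S"
      "measure lebesgue (convex hull {a', b', c'} - convex hull {a, b, c}) \<le> S"
  shows "norm (loop F a b c - loop F a' b' c') \<le> 9000 * K * S powr \<beta>"
proof (cases "4000 * S \<le> det3 a b c")
  case True
  have b: "norm (loop F x y z) \<le> 648 * (K * S powr \<beta>)"
    if "\<bar>det3 x y z\<bar> \<le> 648 * S" "x \<in> V" "y \<in> V" "z \<in> V" for x y z
  proof -
    have "\<bar>det3 x y z\<bar> powr \<beta> \<le> (648 * S) powr \<beta>" using that(1) K by (intro powr_mono2) auto
    also have "\<dots> \<le> 648 * S powr \<beta>" using S K by (intro powr_scale_le) auto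
    finally have "K * \<bar>det3 x y z\<bar> powr \<beta> \<le> K * (648 * S powr \<beta>)"
      using K(1) by (intro mult_left_mono)
    with bd[OF that(2-4)] show ?thesis by linarith
  qed
  obtain a'' b'' c'' where q: "(a'', b'', c'') \<in> {(a', b', c'), (b', c', a'), (c', a', b')}"
    "\<bar>det3 a b a''\<bar> \<le> 648 * S" "\<bar>det3 c a a''\<bar> \<le> 648 * S"
    "\<bar>det3 b c b''\<bar> \<le> 648 * S" "\<bar>det3 a'' b b''\<bar> \<le> 648 * S"
    "\<bar>det3 c a'' c''\<bar> \<le> 648 * S" "\<bar>det3 b'' c c''\<bar> \<le> 648 * S"
    using close_triangles_match[OF D S True m] by (elim exE conjE) (rule that)
  have inV: "a \<in> V" "b \<in> V" "c \<in> V" "a'' \<in> V" "b'' \<in> V" "c'' \<in> V" using V q(1) by auto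
  have eq: "loop F a'' b'' c'' = loop F a' b' c'"
    using q(1) loop_rotate[of F a' b' c'] loop_rotate[of F b' c' a'] by auto
  have t: "norm (u + v) \<le> s + t" if "norm u \<le> s" "norm v \<le> t" for u v :: 'e and s t
    using that norm_triangle_ineq[of u v] by linarith
  have "norm (loop F a b c - loop F a'' b'' c'') \<le> 648 * (K * S powr \<beta>) + 648 * (K * S powr \<beta>)
      + 648 * (K * S powr \<beta>) + 648 * (K * S powr \<beta>) + 648 * (K * S powr \<beta>) + 648 * (K * S powr \<beta>)"
    unfolding loop_diff[of F, OF anti] by (intro t b q(2-) inV)
  moreover have "0 \<le> K * S powr \<beta>" using K by simp
  ultimately show ?thesis unfolding eq by (simp add: mult.assoc)
next
  case False
  define T T' where "T = convex hull {a, b, c}" and "T' = convex hull {a', b', c'}"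
  have T: "T \<in> lmeasurable" "T' \<in> lmeasurable"
    unfolding T_def T'_def by (auto intro!: lmeasurable_compact finite_imp_compact_convex_hull)
  have "measure lebesgue (T \<union> T') = measure lebesgue T + measure lebesgue (T' - T)"
    using measure_Un2[of T lebesgue T'] T by simp
  moreover have "measure lebesgue T' \<le> measure lebesgue (T \<union> T')"
    using T by (intro measure_mono_fmeasurable) (auto intro: fmeasurable.Un)
  moreover have "measure lebesgue T = det3 a b c / 2" "measure lebesgue T' = det3 a' b' c' / 2"
    using D by (simp_all add: T_def T'_def measure_triangle)
  ultimately have "det3 a' b' c' \<le> 4002 * S"
    using False m(2)[folded T_def T'_def] by linarith
  moreover have "det3 a b c \<le> 4002 * S" using False S by simp
  moreover have "norm (loop F x y z) \<le> K * (4002 * S powr \<beta>)"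
    if "\<bar>det3 x y z\<bar> \<le> 4002 * S" "x \<in> V" "y \<in> V" "z \<in> V" for x y z
  proof -
    have "\<bar>det3 x y z\<bar> powr \<beta> \<le> (4002 * S) powr \<beta>" using that(1) K by (intro powr_mono2) auto
    also have "\<dots> \<le> 4002 * S powr \<beta>" using S K by (intro powr_scale_le) auto
    finally have "K * \<bar>det3 x y z\<bar> powr \<beta> \<le> K * (4002 * S powr \<beta>)"
      using K(1) by (intro mult_left_mono)
    with bd[OF that(2-4)] show ?thesis by linarith
  qed
  ultimately have "norm (loop F a b c) \<le> K * (4002 * S powr \<beta>)"
    "norm (loop F a' b' c') \<le> K * (4002 * S powr \<beta>)"
    using V D by simp_all
  moreover have "0 \<le> K * S powr \<beta>" using K by simp
  ultimately show ?thesis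
    using norm_triangle_ineq4[of "loop F a b c" "loop F a' b' c'"] by linarith
qed

text \<open>For negative orientation, exchanging the last two vertices reverses both loops and
  preserves both hulls.\<close>

lemma loop_symm_bound:
  fixes F :: "real^2 \<Rightarrow> real^2 \<Rightarrow> 'e::real_normed_vector"
  assumes anti: "\<And>p q. F q p = - F p q" and K: "0 \<le> K" "0 \<le> \<beta>" "\<beta> \<le> 1"
    and bd: "\<And>x y z. x \<in> V \<Longrightarrow> y \<in> V \<Longrightarrow> z \<in> V \<Longrightarrow> norm (loop F x y z) \<le> K * \<bar>det3 x y z\<bar> powr \<beta>"
    and V: "{a, b, c, a', b', c'} \<subseteq> V"
    and D: "0 < det3 a b c * det3 a' b' c'" and S: "0 < S"
    and m: "measure lebesgue (convex hull {a, b, c} - convex hull {a', b', c'}) \<le> S"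
      "measure lebesgue (convex hull {a', b', c'} - convex hull {a, b, c}) \<le> S"
  shows "norm (loop F a b c - loop F a' b' c') \<le> 9000 * K * S powr \<beta>"
proof (cases "0 < det3 a b c")
  case True
  then have "0 < det3 a' b' c'" using D by (simp add: zero_less_mult_iff)
  from loop_symm_bound_pos[of F, OF anti K bd V True this S m] show ?thesis .
next
  case False
  then have D': "0 < det3 a c b" "0 < det3 a' c' b'"
    using D by (simp_all add: det3_swap[of a c b] det3_swap[of a' c' b'] zero_less_mult_iff)
  have e: "{a, b, c} = {a, c, b}" "{a', b', c'} = {a', c', b'}" by auto
  have V': "{a, c, b, a', c', b'} \<subseteq> V" using V by auto
  from loop_symm_bound_pos[of F, OF anti K bd V' D' S m[unfolded e]]
  have "norm (loop F a c b - loop F a' c' b') \<le> 9000 * K * S powr \<beta>" .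
  moreover have "loop F a c b - loop F a' c' b' = - (loop F a b c - loop F a' b' c')"
    using loop_swap[of F a b c, OF anti] loop_swap[of F a' b' c', OF anti] by simp
  ultimately show ?thesis by (simp add: norm_minus_commute)
qed


subsection \<open>Additive functionals on segments\<close>

lemma sqrt_powr: "0 \<le> x \<Longrightarrow> sqrt x powr \<alpha> = x powr (\<alpha> / 2)"
  by (simp add: powr_half_sqrt[symmetric] powr_powr)

lemma cross2_eq_0:
  assumes "cross2 u v = 0" "u \<noteq> 0"
  shows "\<exists>t. v = t *\<^sub>R u"
proof (cases "u $ 1 = 0")
  case True
  then have "v = (v $ 2 / u $ 2) *\<^sub>R u"
    using assms by (auto simp: cross2_def vec_eq_iff forall_2)
  then show ?thesis by blast
next
  case False
  then have "v = (v $ 1 / u $ 1) *\<^sub>R u"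
    using assms by (auto simp: cross2_def vec_eq_iff forall_2 field_simps)
  then show ?thesis by blast
qed

lemma seg_simps [simp]:
  "seg_i (wrap p, v) = wrap p" "seg_f (wrap p, v) = wrap (p + v)" "seg_len (x, v) = norm v"
  "wrap 0 = 0"
  by (simp_all add: seg_i_def seg_f_def seg_len_def wrap_small)

lemma seg_area_common_start: "seg_area (wrap p, q - p) (wrap p, r - p) = \<bar>det3 p q r\<bar> / 2"
proof -
  have "{0, q - p, r - p, 0} = {0, q - p, r - p}" by auto
  then show ?thesis
    using measure_triangle[of 0 "q - p" "r - p"] by (simp add: seg_area_def det3_def)
qed

text \<open>Where \<open>g\<close> vanishes, the quotient is 0 by convention.\<close>

lemma SUP_quotient_leI:
  fixes f g :: "'a \<Rightarrow> real"
  assumes "0 \<le> K" "\<And>x. x \<in> I \<Longrightarrow> 0 \<le> g x" "\<And>x. x \<in> I \<Longrightarrow> f x \<le> K * g x"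
  shows "(SUP x\<in>I. ennreal (f x / g x)) \<le> ennreal K"
proof (rule SUP_least, rule ennreal_leI)
  fix x assume "x \<in> I"
  then show "f x / g x \<le> K" using assms by (cases "g x = 0") (auto simp: pos_divide_le_eq less_le)
qed

lemma SUP_quotient_leD:
  fixes f g :: "'a \<Rightarrow> real"
  assumes "(SUP x\<in>I. ennreal (f x / g x)) \<le> ennreal K" "0 \<le> K" "x \<in> I" "0 < g x"
  shows "f x \<le> K * g x"
proof -
  have "ennreal (f x / g x) \<le> ennreal K" using assms(1,3) by (meson SUP_le_iff)
  then show ?thesis using assms(2,4) by (simp add: pos_divide_le_eq)
qed

locale additive_functional =
  fixes A :: "seg \<Rightarrow> 'e::banach" and \<alpha> :: real
  assumes A_Omega: "A \<in> Omega" and \<alpha>: "0 \<le> \<alpha>" "\<alpha> \<le> 1"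
begin

text \<open>Invariant under integer translations of both points together, since only
  \<open>wrap p\<close> and \<open>q - p\<close> enter. Lifts can therefore be chosen
  freely.\<close>

definition F :: "pt \<Rightarrow> pt \<Rightarrow> 'e" where
  "F p q = A (wrap p, q - p)"

lemma A_eq_F: "l \<in> Xsp \<Longrightarrow> A l = F (fst l) (fst l + snd l)"
  by (auto simp: F_def Xsp_def wrap_torus)

lemma in_Xsp: "norm v \<le> 1/4 \<Longrightarrow> (wrap p, v) \<in> Xsp"
  by (simp add: Xsp_def)

lemma F_join:
  assumes "norm w = 1" "\<bar>c\<bar> \<le> 1/4" "\<bar>c'\<bar> \<le> 1/4" "\<bar>c + c'\<bar> \<le> 1/4"
  shows "F p (p + (c + c') *\<^sub>R w) = F p (p + c *\<^sub>R w) + F (p + c *\<^sub>R w) (p + (c + c') *\<^sub>R w)"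
proof -
  let ?l = "(wrap p, c *\<^sub>R w)" and ?l' = "(wrap (p + c *\<^sub>R w), c' *\<^sub>R w)"
  have "joinable ?l ?l'"
    unfolding joinable_def using assms
    by (intro conjI exI[of _ w] exI[of _ c] exI[of _ c']) (auto simp: in_Xsp seg_f_def abs_le_iff)
  then have "A (seg_join ?l ?l') = A ?l + A ?l'" using A_Omega by (simp add: Omega_def)
  then show ?thesis by (simp add: seg_join_def F_def scaleR_left_distrib)
qed

lemma F_self [simp]: "F p p = 0"
  using F_join[of "axis 1 1" 0 0 p] by simp

text \<open>\<open>q\<close> may lie outside the segment from \<open>p\<close> to \<open>r\<close>,
  as \<open>joinable\<close> admits coefficients of either sign; only the three distances are
  limited.\<close>

lemma F_collinear:
  assumes "q = p + t *\<^sub>R (r - p)" "norm (q - p) \<le> 1/4" "norm (r - q) \<le> 1/4" "norm (r - p) \<le> 1/4"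
  shows "F p r = F p q + F q r"
proof (cases "r = p")
  case True
  then show ?thesis using assms(1) by simp
next
  case False
  define n where "n = norm (r - p)"
  define w where "w = (1 / n) *\<^sub>R (r - p)"
  have n: "n > 0" using False by (simp add: n_def)
  have nw: "n *\<^sub>R w = r - p" "norm w = 1" using n by (auto simp: w_def n_def)
  have q: "q = p + (t * n) *\<^sub>R w" unfolding assms(1) nw(1)[symmetric] by simp
  have r: "r = p + (t * n + (1 - t) * n) *\<^sub>R w"
    using nw(1) by (simp add: algebra_simps)
  have "r - q = ((1 - t) * n) *\<^sub>R w" unfolding q using nw(1) by (simp add: algebra_simps)
  then have "\<bar>(1 - t) * n\<bar> \<le> 1/4" using assms(3) nw(2) by (metis mult.right_neutral norm_scaleR)
  moreover have "\<bar>t * n\<bar> \<le> 1/4" using assms(2) nw(2) unfolding q by simp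
  moreover have "\<bar>t * n + (1 - t) * n\<bar> \<le> 1/4" using assms(4) n by (simp add: algebra_simps n_def)
  ultimately show ?thesis using F_join[OF nw(2), of "t * n" "(1 - t) * n" p] q r by metis
qed

lemma F_anti: "norm (q - p) \<le> 1/4 \<Longrightarrow> F q p = - F p q"
proof (cases "q = p")
  case False
  assume a: "norm (q - p) \<le> 1/4"
  define w where "w = (1 / norm (q - p)) *\<^sub>R (q - p)"
  have w: "norm (q - p) *\<^sub>R w = q - p" "norm w = 1" using False by (auto simp: w_def)
  show ?thesis
    using F_join[OF w(2), of "norm (q - p)" "- norm (q - p)" p] a w(1) by (simp add: eq_neg_iff_add_eq_0 add.commute)
qed simp

lemma loop_degenerate:
  assumes "det3 p q r = 0" "norm (q - p) \<le> 1/4" "norm (r - q) \<le> 1/4" "norm (p - r) \<le> 1/4"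
  shows "loop F p q r = 0"
proof (cases "q = p")
  case True
  then show ?thesis using F_anti[of r p] assms by (simp add: loop_def)
next
  case False
  then obtain t where "r - p = t *\<^sub>R (q - p)"
    using cross2_eq_0[of "q - p" "r - p"] assms(1) by (auto simp: det3_def)
  then have "r = p + t *\<^sub>R (q - p)" by (simp add: algebra_simps)
  then have "F p q = F p r + F r q"
    using assms by (intro F_collinear) (auto simp: norm_minus_commute)
  then show ?thesis
    using F_anti[of r q] F_anti[of p r] assms by (simp add: loop_def norm_minus_commute)
qed

section \<open>The two intermediate bounds\<close>

text \<open>Since \<open>0 powr 0 = 0\<close>, at \<alpha> = 0 this includes
  \<open>F p p = 0\<close>. The suprema say nothing about coincident points, which are therefore
  treated apart through \<open>F_self\<close>.\<close>

definition growth :: "real \<Rightarrow> bool" where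
  "growth K \<longleftrightarrow> 0 \<le> K \<and> (\<forall>p q. norm (q - p) \<le> 1/4 \<longrightarrow> norm (F p q) \<le> K * norm (q - p) powr \<alpha>)"

definition three_point :: "real \<Rightarrow> bool" where
  "three_point K \<longleftrightarrow> 0 \<le> K \<and> (\<forall>p q r. norm (q - p) \<le> 1/4 \<longrightarrow> norm (r - p) \<le> 1/4 \<longrightarrow>
     norm (F p q - F p r) \<le> K * (norm (r - q) + sqrt \<bar>det3 p q r\<bar>) powr \<alpha>)"

lemma powr_le: "0 \<le> x \<Longrightarrow> x \<le> y \<Longrightarrow> 0 \<le> K \<Longrightarrow> K * x powr \<alpha> \<le> K * y powr \<alpha>"
  using \<alpha> by (intro mult_left_mono powr_mono2) auto

lemma powr_le_scale:
  assumes "0 \<le> x" "x \<le> c * y" "0 \<le> y" "1 \<le> c" "0 \<le> K"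
  shows "K * x powr \<alpha> \<le> (c * K) * y powr \<alpha>"
proof -
  have "K * x powr \<alpha> \<le> K * (c * y) powr \<alpha>" using assms by (intro powr_le) auto
  also have "\<dots> \<le> K * (c * y powr \<alpha>)" using assms \<alpha> by (intro mult_left_mono powr_scale_le)
  finally show ?thesis by (simp add: mult_ac)
qed

lemma growthD: "growth K \<Longrightarrow> norm (q - p) \<le> 1/4 \<Longrightarrow> norm (q - p) \<le> x \<Longrightarrow> norm (F p q) \<le> K * x powr \<alpha>"
  unfolding growth_def using powr_le[of "norm (q - p)" x K] by fastforce

lemma growth_mono: "growth K \<Longrightarrow> K \<le> L \<Longrightarrow> growth L"
  unfolding growth_def by (meson mult_right_mono order_trans powr_ge_zero)

lemma three_point_mono: "three_point K \<Longrightarrow> K \<le> L \<Longrightarrow> three_point L"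
  unfolding three_point_def by (meson mult_right_mono order_trans powr_ge_zero)

section \<open>From the norms to the intermediate bounds\<close>

lemma hol_normD:
  assumes "hol_norm \<alpha> A \<le> ennreal K" "0 \<le> K" "l \<in> Xsp" "l' \<in> Xsp" "0 < rho l l'"
  shows "norm (A l - A l') \<le> K * rho l l' powr \<alpha>"
  using SUP_quotient_leD[OF assms(1)[unfolded hol_norm_def] assms(2), of "(l, l')"] assms(3-5)
  by simp

lemma hol_imp_growth:
  assumes h: "hol_norm \<alpha> A \<le> ennreal K" "0 \<le> K"
  shows "growth K"
  unfolding growth_def
proof (intro conjI allI impI)
  fix p q :: pt assume a: "norm (q - p) \<le> 1/4"
  show "norm (F p q) \<le> K * norm (q - p) powr \<alpha>"
  proof (cases "q = p")
    case False
    \<comment> \<open>The comparison segment has length 0, so the threshold in \<open>far\<close> is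
      0 and \<open>rho\<close> reduces to the length of the other segment.\<close>
    let ?l = "(wrap p, q - p)" and ?l' = "(wrap p, 0)"
    have "far ?l ?l'" using a False by (simp add: far_def wrap_small)
    then have r: "rho ?l ?l' = norm (q - p)" by (simp add: rho_def)
    have "norm (A ?l - A ?l') \<le> K * rho ?l ?l' powr \<alpha>"
      using a False by (intro hol_normD[OF h] in_Xsp) (simp_all add: r)
    moreover have "A ?l' = 0" using F_self[of p] unfolding F_def by simp
    ultimately show ?thesis by (simp add: r F_def)
  qed (use h in simp)
qed (use h in simp)

lemma hol_imp_three_point:
  assumes h: "hol_norm \<alpha> A \<le> ennreal K" "0 \<le> K"
  shows "three_point (9 * K)"
  unfolding three_point_def
proof (intro conjI allI impI)
  fix p q r :: pt assume a: "norm (q - p) \<le> 1/4" "norm (r - p) \<le> 1/4"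
  let ?l = "(wrap p, q - p)" and ?l' = "(wrap p, r - p)"
  define D where "D = norm (r - q) + sqrt \<bar>det3 p q r\<bar>"
  have n: "norm (q - p) \<le> norm (r - p) + norm (r - q)" "norm (r - p) \<le> norm (q - p) + norm (r - q)"
    "norm (r - q) \<le> norm (r - p) + norm (q - p)"
    using norm_triangle_ineq4[of "r - p" "r - q"] norm_triangle_ineq[of "q - p" "r - q"]
      norm_triangle_ineq4[of "r - p" "q - p"] by simp_all
  have D: "norm (r - q) \<le> D" by (simp add: D_def)
  have f: "tdist (seg_f ?l) (seg_f ?l') = norm (wrap (q - r))"
    by simp
  show "norm (F p q - F p r) \<le> 9 * K * D powr \<alpha>"
  proof (cases "q = r")
    case False
    have "0 < rho ?l ?l' \<and> rho ?l ?l' \<le> 9 * D"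
    proof (cases "far ?l ?l'")
      case True
      then have "1/4 * min (norm (q - p)) (norm (r - p)) < max 0 (norm (wrap (q - r)))"
        unfolding far_def f by simp
      \<comment> \<open>Far with a common start: the shorter length is below 4 |r - q| and the
        longer below 5 |r - q|, which gives the 9.\<close>
      then have "min (norm (q - p)) (norm (r - p)) < 4 * norm (r - q)"
        using norm_wrap_le[of "q - r"] False norm_minus_commute[of q r] by (auto simp: max_def split: if_splits)
      then have "norm (q - p) + norm (r - p) \<le> 9 * norm (r - q)" using n by linarith
      moreover have "0 < norm (q - p) + norm (r - p)" using n(3) False by (smt (verit) zero_less_norm_iff right_minus_eq)
      ultimately show ?thesis using True D by (simp add: rho_def)
    next
      case nf: False
      then have "norm (wrap (q - r)) \<le> 1/4 * min (norm (q - p)) (norm (r - p))"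
        unfolding far_def f seg_simps not_less by simp
      \<comment> \<open>A small torus distance could come from another lattice translate; here the
        planar distance is at most 1/2, which excludes that.\<close>
      then have "wrap (q - r) = q - r"
        using a n norm_minus_commute[of q r] by (intro wrap_eq_self) linarith
      define a where "a = sqrt (\<bar>det3 p q r\<bar> / 2)"
      have "rho ?l ?l' = norm (r - q) + a" using \<open>wrap (q - r) = q - r\<close>
        using nf f unfolding rho_def a_def by (simp add: seg_area_common_start norm_minus_commute[of q r])
      moreover have "norm (r - q) + a \<le> D"
        unfolding a_def D_def by (intro add_left_mono real_sqrt_le_mono) simp
      moreover have "0 \<le> a" "0 < norm (r - q)" using False by (simp_all add: a_def)
      ultimately show ?thesis by (intro conjI) linarith+
    qed
    then have "norm (A ?l - A ?l') \<le> K * rho ?l ?l' powr \<alpha>" "K * rho ?l ?l' powr \<alpha> \<le> 9 * K * D powr \<alpha>"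
      using a h D by (auto intro!: hol_normD in_Xsp powr_le_scale intro: order_trans[OF norm_ge_zero])
    then show ?thesis by (simp add: F_def)
  qed (use h in simp)
qed (use h in simp)

lemma gr_imp_growth:
  assumes g: "gr_norm \<alpha> A \<le> ennreal K" "0 \<le> K"
  shows "growth K"
  unfolding growth_def
proof (intro conjI allI impI)
  fix p q :: pt assume a: "norm (q - p) \<le> 1/4"
  show "norm (F p q) \<le> K * norm (q - p) powr \<alpha>"
  proof (cases "q = p")
    case False
    then show ?thesis
      using SUP_quotient_leD[OF g(1)[unfolded gr_norm_def] g(2), of "(wrap p, q - p)"] a
      by (simp add: F_def in_Xsp)
  qed (use g in simp)
qed (use g in simp)

lemma norm_A_le:
  assumes "growth K" "l \<in> Xsp" "seg_len l \<le> x"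
  shows "norm (A l) \<le> K * x powr \<alpha>"
  using growthD[of K "fst l + snd l" "fst l" x] assms
  by (auto simp: A_eq_F seg_len_def Xsp_def)

lemma growth_imp_gr: "growth K \<Longrightarrow> gr_norm \<alpha> A \<le> ennreal K"
  unfolding gr_norm_def by (rule SUP_quotient_leI) (auto simp: growth_def[of K] intro: norm_A_le)

text \<open>With n the squared leg and x the squared chord, the squared cross product is x (n -
  x/4), and 16 x \<le> n makes this at least x squared. So the chord of a vee is controlled by its
  area, and distinct legs enclose positive area.\<close>

lemma vee_det_lower:
  fixes v w :: pt
  assumes "norm v = norm w" "norm (v - w) \<le> norm v / 4"
  shows "(norm (v - w))\<^sup>2 \<le> \<bar>cross2 v w\<bar>"
proof -
  define x where "x = (norm (v - w))\<^sup>2"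
  define n where "n = (norm v)\<^sup>2"
  have x: "x = 2 * n - 2 * (v \<bullet> w)"
    unfolding x_def n_def using assms(1)
    by (simp add: power2_norm_eq_inner inner_diff inner_commute) (simp flip: power2_norm_eq_inner)
  have "x \<le> (norm v / 4)\<^sup>2" unfolding x_def using assms(2) by (intro power_mono) auto
  then have xn: "16 * x \<le> n" by (simp add: n_def power_divide)
  have x0: "0 \<le> x" by (simp add: x_def)
  have "v \<bullet> w = n - x / 2" using x by linarith
  then have "(cross2 v w)\<^sup>2 = n * n - (n - x / 2)\<^sup>2"
    unfolding cross2_sq using assms(1) by (simp add: n_def)
  also have "\<dots> = x * (n - x / 4)" by (simp add: power2_eq_square algebra_simps)
  also have "\<dots> \<ge> x * x" using xn x0 by (intro mult_left_mono) linarith+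
  finally have "x\<^sup>2 \<le> (cross2 v w)\<^sup>2" by (simp add: power2_eq_square)
  then show ?thesis unfolding x_def[symmetric] by (metis abs_le_square_iff abs_of_nonneg x_def zero_le_power2)
qed

lemma is_veeD:
  assumes "l \<in> Xsp" "l' \<in> Xsp" "is_vee l l'" "l \<noteq> l'"
  obtains p q r where "l = (wrap p, q - p)" "l' = (wrap p, r - p)" "norm (q - p) \<le> 1/4"
    "norm (r - p) \<le> 1/4" "(norm (r - q))\<^sup>2 \<le> \<bar>det3 p q r\<bar>" "q \<noteq> r"
proof -
  obtain p v w where l: "l = (p, v)" "l' = (p, w)" "p \<in> torus" "norm v \<le> 1/4" "norm w \<le> 1/4"
    "norm v = norm w" "v \<noteq> w"
    using assms by (cases l; cases l') (auto simp: is_vee_def seg_i_def seg_len_def Xsp_def)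
  have "\<not> far l l'" using assms by (simp add: is_vee_def)
  then have "norm (wrap (v - w)) \<le> norm v / 4"
    using l by (simp add: far_def seg_f_def seg_len_def tdist_def not_less)
  moreover from this have "wrap (v - w) = v - w"
    using l norm_triangle_ineq4[of v w] by (intro wrap_eq_self) linarith
  ultimately have "(norm (v - w))\<^sup>2 \<le> \<bar>cross2 v w\<bar>" using vee_det_lower l by simp
  then show ?thesis
    using l by (intro that[of p "p + v" "p + w"])
      (auto simp: wrap_torus det3_def norm_minus_commute)
qed

text \<open>The longer segment is cut at \<open>s\<close> to the length of the shorter. The piece
  cut off is no longer than \<open>r - q\<close>, so growth controls it. The remaining equal legs
  either form a vee or have length below 8 |r - q|, where growth suffices again.\<close>

lemma vee_imp_three_point:
  assumes g: "growth K" and v: "vee_norm \<alpha> A \<le> ennreal K"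
  shows "three_point (18 * K)"
proof -
  have K: "0 \<le> K" using g by (simp add: growth_def)
  have main: "norm (F p q - F p r) \<le> 18 * K * D powr \<alpha>"
    if a: "norm (q - p) \<le> 1/4" "norm (r - p) \<le> 1/4" "norm (q - p) \<le> norm (r - p)"
      and D: "D = norm (r - q) + sqrt \<bar>det3 p q r\<bar>" for p q r D
  proof (cases "r = p")
    case True
    then have "q = p" using a by simp
    then show ?thesis using True K by simp
  next
    case False
    define t where "t = norm (q - p) / norm (r - p)"
    define s where "s = p + t *\<^sub>R (r - p)"
    have t: "0 \<le> t" "t \<le> 1" using a False by (auto simp: t_def divide_le_eq_1)
    have sp: "norm (s - p) = norm (q - p)" using False by (simp add: s_def t_def)
    have rs: "r - s = (1 - t) *\<^sub>R (r - p)" by (simp add: s_def algebra_simps)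
    have "t * norm (r - p) = norm (q - p)" using False by (simp add: t_def)
    then have "norm (r - s) = norm (r - p) - norm (q - p)"
      unfolding rs using t by (simp add: left_diff_distrib)
    also have "\<dots> \<le> norm (r - q)" using norm_triangle_ineq2[of "r - p" "q - p"] by simp
    finally have nrs: "norm (r - s) \<le> norm (r - q)" .
    have nqs: "norm (q - s) \<le> 2 * norm (r - q)"
      using norm_triangle_ineq4[of "r - s" "r - q"] nrs by simp
    have "norm (r - s) \<le> 1/4" unfolding rs using t a(2) mult_left_le_one_le[of "norm (r - p)" "1 - t"] by simp
    then have split: "F p r = F p s + F s r"
      using a sp by (intro F_collinear[of s p t r]) (auto simp: s_def)
    have D0: "norm (r - q) \<le> D" "0 \<le> D" by (auto simp: D)
    have 1: "norm (F s r) \<le> K * D powr \<alpha>"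
      using \<open>norm (r - s) \<le> 1/4\<close> nrs D0 by (intro growthD[OF g]) auto
    have 2: "norm (F p q - F p s) \<le> 17 * (K * D powr \<alpha>)"
    proof -
      have nn: "0 \<le> K * D powr \<alpha>" using K by simp
      \<comment> \<open>The last two cases cost 1 and 2 * 8 = 16; with the piece from
        \<open>s\<close> to \<open>r\<close> the total stays within 18.\<close>
      consider "q = s" | "q \<noteq> s" "norm (q - s) \<le> norm (q - p) / 4" | "norm (q - p) < 4 * norm (q - s)"
        by linarith
      then show ?thesis
      proof cases
        case 1
        then show ?thesis using nn by simp
      next
        case 2
        let ?l = "(wrap p, q - p)" and ?l' = "(wrap p, s - p)"
        have "is_vee ?l ?l'"
          using 2(2) sp norm_wrap_le[of "q - s"] by (simp add: is_vee_def far_def not_less)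
        have X: "?l \<in> Xsp" "?l' \<in> Xsp" using a sp by (auto intro: in_Xsp)
        have "0 < \<bar>det3 p q s\<bar>"
        proof -
          have "(norm ((q - p) - (s - p)))\<^sup>2 \<le> \<bar>cross2 (q - p) (s - p)\<bar>"
            using 2(2) sp by (intro vee_det_lower) simp_all
          then have "(norm (q - s))\<^sup>2 \<le> \<bar>det3 p q s\<bar>" by (simp add: det3_def)
          moreover have "0 < (norm (q - s))\<^sup>2" using 2 by simp
          ultimately show ?thesis by linarith
        qed
        then have "norm (A ?l - A ?l') \<le> K * (\<bar>det3 p q s\<bar> / 2) powr (\<alpha> / 2)"
          using SUP_quotient_leD[OF v[unfolded vee_norm_def] K, of "(?l, ?l')"] X \<open>is_vee ?l ?l'\<close> 2(1)
          by (simp add: seg_area_common_start)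
        also have "det3 p q s = t * det3 p q r" by (simp add: s_def det3_coord algebra_simps)
        also have "K * (\<bar>t * det3 p q r\<bar> / 2) powr (\<alpha> / 2) = K * sqrt (\<bar>t * det3 p q r\<bar> / 2) powr \<alpha>"
          by (simp add: sqrt_powr)
        also have "\<dots> \<le> K * D powr \<alpha>"
        proof (rule powr_le)
          have "\<bar>t * det3 p q r\<bar> \<le> \<bar>det3 p q r\<bar>" using t by (simp add: abs_mult mult_left_le_one_le)
          then have "sqrt (\<bar>t * det3 p q r\<bar> / 2) \<le> sqrt \<bar>det3 p q r\<bar>" by simp
          then show "sqrt (\<bar>t * det3 p q r\<bar> / 2) \<le> D" unfolding D by (simp add: add_increasing)
        qed (use K in auto)
        finally show ?thesis using nn by (simp add: F_def)
      next
        case 3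
        have d: "norm (q - p) \<le> 8 * D" "norm (s - p) \<le> 8 * D" using 3 nqs D0 sp by linarith+
        have e: "K * norm (q - p) powr \<alpha> \<le> (8 * K) * D powr \<alpha>"
          using d D0 K by (intro powr_le_scale) auto
        have "norm (F p q) \<le> K * norm (q - p) powr \<alpha>" "norm (F p s) \<le> K * norm (q - p) powr \<alpha>"
          using a sp by (auto intro!: growthD[OF g])
        then show ?thesis using e nn norm_triangle_ineq4[of "F p q" "F p s"] by linarith
      qed
    qed
    have eq: "F p q - F p r = (F p q - F p s) - F s r" by (simp add: split)
    show ?thesis
      unfolding eq using 1 2 norm_triangle_ineq4[of "F p q - F p s" "F s r"] by linarith
  qed
  show ?thesis
    unfolding three_point_def
  proof (intro conjI allI impI)
    fix p q r :: pt assume a: "norm (q - p) \<le> 1/4" "norm (r - p) \<le> 1/4"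
    show "norm (F p q - F p r) \<le> 18 * K * (norm (r - q) + sqrt \<bar>det3 p q r\<bar>) powr \<alpha>"
    proof (cases "norm (q - p) \<le> norm (r - p)")
      case True
      then show ?thesis using main a by blast
    next
      case False
      then show ?thesis
        using main[OF a(2,1) _ refl] by (simp add: det3_swap[of p q r] norm_minus_commute)
    qed
  qed (use K in simp)
qed

text \<open>The difference of the two segments is the loop minus \<open>F q r\<close>, and |r - q|
  is part of the three-point bound. If \<open>q\<close> and \<open>r\<close> are more than 1/4 apart
  no loop is available, but then both segments are shorter than \<open>r - q\<close> and growth
  suffices.\<close>

lemma loop_imp_three_point:
  assumes g: "growth K"
    and l: "\<And>p q r. norm (q - p) \<le> 1/4 \<Longrightarrow> norm (r - q) \<le> 1/4 \<Longrightarrow> norm (p - r) \<le> 1/4 \<Longrightarrow>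
      det3 p q r \<noteq> 0 \<Longrightarrow> norm (loop F p q r) \<le> K * \<bar>det3 p q r\<bar> powr (\<alpha> / 2)"
  shows "three_point (9 * K)"
  unfolding three_point_def
proof (intro conjI allI impI)
  have K: "0 \<le> K" using g by (simp add: growth_def)
  then show "0 \<le> 9 * K" by simp
  fix p q r :: pt assume a: "norm (q - p) \<le> 1/4" "norm (r - p) \<le> 1/4"
  define D where "D = norm (r - q) + sqrt \<bar>det3 p q r\<bar>"
  have D: "norm (r - q) \<le> D" "sqrt \<bar>det3 p q r\<bar> \<le> D" by (auto simp: D_def)
  have nn: "0 \<le> K * D powr \<alpha>" using K by simp
  have "norm (F p q - F p r) \<le> 2 * (K * D powr \<alpha>)"
  proof (cases "norm (r - q) \<le> 1/4")
    case True
    have "norm (loop F p q r) \<le> K * \<bar>det3 p q r\<bar> powr (\<alpha> / 2)"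
      using l[of q p r] loop_degenerate[of p q r] a True K
      by (cases "det3 p q r = 0") (auto simp: norm_minus_commute)
    also have "\<dots> = K * sqrt \<bar>det3 p q r\<bar> powr \<alpha>" by (simp add: sqrt_powr)
    also have "\<dots> \<le> K * D powr \<alpha>" using D K by (intro powr_le) auto
    finally have 1: "norm (loop F p q r) \<le> K * D powr \<alpha>" .
    have 2: "norm (F q r) \<le> K * D powr \<alpha>" using True D by (intro growthD[OF g])
    have "F p q - F p r = loop F p q r - F q r"
      using F_anti[of r p] a by (simp add: loop_def)
    then show ?thesis using 1 2 norm_triangle_ineq4[of "loop F p q r" "F q r"] by simp
  next
    case False
    then have "norm (F p q) \<le> K * D powr \<alpha>" "norm (F p r) \<le> K * D powr \<alpha>"
      using a D by (auto intro!: growthD[OF g])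
    then show ?thesis using norm_triangle_ineq4[of "F p q" "F p r"] by simp
  qed
  then show "norm (F p q - F p r) \<le> 9 * K * (norm (r - q) + sqrt \<bar>det3 p q r\<bar>) powr \<alpha>"
    using nn unfolding D_def by linarith
qed

end


subsection \<open>Lifting triangles to the plane\<close>

definition short :: "pt \<Rightarrow> pt \<Rightarrow> pt \<Rightarrow> bool" where
  "short p q r \<longleftrightarrow> norm (q - p) \<le> 1/4 \<and> norm (r - q) \<le> 1/4 \<and> norm (p - r) \<le> 1/4"

definition lift_tri :: "pt \<Rightarrow> pt \<Rightarrow> pt \<Rightarrow> tri" where
  "lift_tri p q r = ((wrap p, q - p), (wrap q, r - q), (wrap r, p - r))"

lemma tri_lift [simp]:
  "tri1 (lift_tri p q r) = (wrap p, q - p)" "tri2 (lift_tri p q r) = (wrap q, r - q)"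
  "tri3 (lift_tri p q r) = (wrap r, p - r)"
  by (simp_all add: lift_tri_def tri1_def tri2_def tri3_def)

lemma short_hull:
  "short p q r \<Longrightarrow> x \<in> convex hull {p, q, r} \<Longrightarrow> y \<in> convex hull {p, q, r} \<Longrightarrow> norm (x - y) \<le> 1/4"
  by (rule triangle_sides_bound) (auto simp: short_def norm_minus_commute)

lemma tri_int_lift: "tri_int (lift_tri p q r) = wrap ` interior (convex hull {p, q, r})"
proof -
  define k where "k = wrap p - p"
  have "{wrap p, wrap p + (q - p), wrap p + (q - p) + (r - q)} = (+) k ` {p, q, r}"
    by (auto simp: k_def)
  then have "tri_int (lift_tri p q r) = wrap ` (+) k ` interior (convex hull {p, q, r})"
    by (simp only: tri_int_def Let_def tri_lift fst_conv snd_conv convex_hull_translation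
        interior_translation)
  moreover have "wrap (k + x) = wrap x" for x
    using int_vec_simps(2)[OF int_vec_wrap_diff[of p]] by (simp add: wrap_eq_iff k_def)
  ultimately show ?thesis by (simp add: image_image)
qed

lemma tri_area_lift: "short p q r \<Longrightarrow> tri_area (lift_tri p q r) = \<bar>det3 p q r\<bar> / 2"
proof -
  assume s: "short p q r"
  have "inj_on wrap (interior (convex hull {p, q, r}))"
    using short_hull[OF s] interior_subset[of "convex hull {p, q, r}"] by (intro inj_on_wrap) force
  then have "tri_area (lift_tri p q r) = measure lebesgue (interior (convex hull {p, q, r}))"
    unfolding tri_area_def tri_int_lift by (intro measure_wrap_image) simp_all
  then show ?thesis by (simp only: measure_interior_hull finite.intros measure_triangle)
qed

lemma tri_orient_lift: "tri_orient (lift_tri p q r) = sgn (det3 p q r)"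
  by (simp add: tri_orient_def det3_coord algebra_simps)

lemma lift_tri_shift: "int_vec k \<Longrightarrow> lift_tri (p + k) (q + k) (r + k) = lift_tri p q r"
  by (simp add: lift_tri_def wrap_eq_iff)

lemma iota_wrap: "iota (wrap p, q - p) = (\<lambda>c. wrap (p + c *\<^sub>R (q - p))) ` {0..<1}"
  by (simp add: iota_def)

lemma iota_subset_hull:
  assumes "x \<in> iota (wrap p, q - p)" "p \<in> S" "q \<in> S"
  shows "x \<in> wrap ` (convex hull S)"
proof -
  obtain c where c: "x = wrap (p + c *\<^sub>R (q - p))" "0 \<le> c" "c < 1"
    using assms(1) unfolding iota_wrap by auto
  have "(1 - c) *\<^sub>R p + c *\<^sub>R q \<in> convex hull S"
    using c assms by (intro convexD_alt) (auto simp: convex_convex_hull hull_inc)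
  then show ?thesis using c(1) by (force simp: algebra_simps)
qed

lemma edges_disjoint:
  assumes s: "short p q r" and d: "det3 p q r \<noteq> 0"
  shows "iota (wrap p, q - p) \<inter> iota (wrap q, r - q) = {}"
proof -
  have False if c: "c < 1" "0 \<le> c" "0 \<le> c'" "c' < 1"
    and e: "wrap (p + c *\<^sub>R (q - p)) = wrap (q + c' *\<^sub>R (r - q))" for c c'
  proof -
    let ?T = "convex hull {p, q, r}"
    have "(1 - c) *\<^sub>R p + c *\<^sub>R q \<in> ?T" "(1 - c') *\<^sub>R q + c' *\<^sub>R r \<in> ?T"
      using c by (intro convexD_alt; auto simp: convex_convex_hull hull_inc)+
    then have "p + c *\<^sub>R (q - p) \<in> ?T" "q + c' *\<^sub>R (r - q) \<in> ?T" by (simp_all add: algebra_simps)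
    moreover have "inj_on wrap ?T" using short_hull[OF s] by (intro inj_on_wrap) force
    ultimately have "p + c *\<^sub>R (q - p) = q + c' *\<^sub>R (r - q)" using e by (simp add: inj_on_def)
    \<comment> \<open>\<open>det3 _ q r\<close> vanishes on the line \<open>qr\<close>, but not on
      the half-open edge from \<open>p\<close>, because \<open>c < 1\<close> leaves out
      \<open>q\<close>.\<close>
    moreover have "det3 (p + c *\<^sub>R (q - p)) q r = (1 - c) * det3 p q r"
      "det3 (q + c' *\<^sub>R (r - q)) q r = 0"
      by (simp_all add: det3_coord algebra_simps)
    ultimately show False using c d by simp
  qed
  then show ?thesis unfolding iota_wrap by force
qed

lemma triangle_lift:
  assumes s: "short p q r" and d: "det3 p q r \<noteq> 0"
  shows "triangle (lift_tri p q r)"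
proof -
  have s': "short q r p" "short r p q" and d': "det3 q r p \<noteq> 0" "det3 r p q \<noteq> 0"
    using s d by (simp_all add: short_def det3_rotate[of q r p] det3_rotate[of p q r, symmetric])
  have hull: "z \<in> wrap ` (convex hull {p, q, r})"
    if "z \<in> iota (wrap p, q - p) \<union> iota (wrap q, r - q) \<union> iota (wrap r, p - r)" for z
    using that iota_subset_hull[of z p q "{p, q, r}"] iota_subset_hull[of z q r "{p, q, r}"]
      iota_subset_hull[of z r p "{p, q, r}"] by auto
  have "tdist x y \<le> 1/4" if xy:
    "x \<in> iota (wrap p, q - p) \<union> iota (wrap q, r - q) \<union> iota (wrap r, p - r)"
    "y \<in> iota (wrap p, q - p) \<union> iota (wrap q, r - q) \<union> iota (wrap r, p - r)" for x y
  proof -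
    obtain x' y' where "x = wrap x'" "y = wrap y'" "x' \<in> convex hull {p, q, r}"
      "y' \<in> convex hull {p, q, r}" using hull[OF xy(1)] hull[OF xy(2)] by blast
    then show ?thesis using short_hull[OF s] tdist_wrap_le order_trans by blast
  qed
  then show ?thesis
    unfolding triangle_def tri_lift
    using edges_disjoint[OF s d] edges_disjoint[OF s'(1) d'(1)] edges_disjoint[OF s'(2) d'(2)] s
    by (simp add: Xsp_def short_def Int_commute)
qed

text \<open>On the torus the sides close up only modulo the lattice. Their sum is an integer vector
  of norm at most 3/4, hence 0, so the lifted triangle closes too.\<close>

lemma triangleE:
  assumes "triangle P"
  obtains p q r where "P = lift_tri p q r" "short p q r"
proof -
  obtain p v p2 v2 p3 v3 where P: "P = ((p, v), (p2, v2), (p3, v3))" by (metis prod.exhaust)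
  have T: "tri1 P = (p, v)" "tri2 P = (p2, v2)" "tri3 P = (p3, v3)"
    by (simp_all add: P tri1_def tri2_def tri3_def)
  note defs = assms[unfolded triangle_def T seg_i_def seg_f_def fst_conv snd_conv]
  from defs have "(p, v) \<in> Xsp" "(p2, v2) \<in> Xsp" "(p3, v3) \<in> Xsp" by blast+
  then have X: "p \<in> torus" "norm v \<le> 1/4" "norm v2 \<le> 1/4" "norm v3 \<le> 1/4"
    by (simp_all add: Xsp_def)
  from defs have w: "p = wrap (p3 + v3)" "p2 = wrap (p + v)" "p3 = wrap (p2 + v2)"
    by blast+
  define q r where "q = p + v" and "r = q + v2"
  have v: "q - p = v" "r - q = v2" by (simp_all add: q_def r_def)
  have p2: "p2 = wrap q" using w(2) by (simp add: q_def)
  have p3: "p3 = wrap r" using w(3) unfolding p2 by (simp add: r_def)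
  have "p = wrap (r + v3)" using w(1) unfolding p3 by simp
  then have "wrap p = wrap (r + v3)" by (metis wrap_wrap)
  moreover have e: "p - (r + v3) = - (v + v2 + v3)" by (simp add: q_def r_def)
  moreover have "norm (v + v2 + v3) < 1"
    using X norm_triangle_ineq[of "v + v2" v3] norm_triangle_ineq[of v v2] by linarith
  ultimately have "p - (r + v3) = 0"
    by (intro int_vec_small) (simp_all only: wrap_eq_iff norm_minus_cancel)
  then have v3: "p - r = v3" by (simp add: algebra_simps)
  show ?thesis
  proof (rule that)
    show "P = lift_tri p q r"
      by (simp add: P lift_tri_def v v3 p2 p3 wrap_torus[OF X(1)])
    show "short p q r" using X by (simp add: short_def v v3)
  qed
qed

context additive_functional
begin

lemma bdry_lift: "bdry A (lift_tri p q r) = loop F p q r"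
  by (simp add: bdry_def loop_def F_def)

lemma tri_imp_three_point:
  assumes g: "growth K" and t: "tri_norm \<alpha> A \<le> ennreal K"
  shows "three_point (9 * K)"
proof (rule loop_imp_three_point[OF g])
  have K: "0 \<le> K" using g by (simp add: growth_def)
  fix p q r assume a: "norm (q - p) \<le> 1/4" "norm (r - q) \<le> 1/4" "norm (p - r) \<le> 1/4"
    and d: "det3 p q r \<noteq> 0"
  have s: "short p q r" using a by (simp add: short_def)
  have "norm (loop F p q r) \<le> K * (\<bar>det3 p q r\<bar> / 2) powr (\<alpha> / 2)"
    using SUP_quotient_leD[OF t[unfolded tri_norm_def] K, of "lift_tri p q r"] d
      triangle_lift[OF s d] by (simp add: tri_area_lift[OF s] bdry_lift)
  also have "\<dots> \<le> K * \<bar>det3 p q r\<bar> powr (\<alpha> / 2)"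
    using K \<alpha> by (intro mult_left_mono powr_mono2) auto
  finally show "norm (loop F p q r) \<le> K * \<bar>det3 p q r\<bar> powr (\<alpha> / 2)" .
qed

text \<open>Comparing a triangle with its reversal, whose boundary integral is the negative, controls the
  integral itself.\<close>

lemma symm_imp_three_point:
  assumes g: "growth K" and t: "symm_norm \<alpha> A \<le> ennreal K"
  shows "three_point (9 * K)"
proof (rule loop_imp_three_point[OF g])
  have K: "0 \<le> K" using g by (simp add: growth_def)
  fix p q r assume a: "norm (q - p) \<le> 1/4" "norm (r - q) \<le> 1/4" "norm (p - r) \<le> 1/4"
    and d: "det3 p q r \<noteq> 0"
  let ?P = "lift_tri p q r" and ?Q = "lift_tri p r q"
  have s: "short p q r" "short p r q" using a by (auto simp: short_def norm_minus_commute)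
  have d': "det3 p r q \<noteq> 0" using d by (simp add: det3_swap[of p q r])
  have "sgn (det3 p q r) \<noteq> sgn (det3 p r q)"
    using d by (simp add: det3_swap[of p r q] sgn_if)
  then have "tri_dist ?P ?Q = \<bar>det3 p q r\<bar>"
    by (simp add: tri_dist_def tri_orient_lift tri_area_lift[OF s(1)] tri_area_lift[OF s(2)]
        det3_swap[of p r q])
  moreover have "loop F p r q = - loop F p q r"
    using F_anti[OF a(1)] F_anti[OF a(2)] F_anti[OF a(3)] by (simp add: loop_def)
  ultimately have "norm (loop F p q r - - loop F p q r) \<le> K * \<bar>det3 p q r\<bar> powr (\<alpha> / 2)"
    using SUP_quotient_leD[OF t[unfolded symm_norm_def] K, of "(?P, ?Q)"] d
      triangle_lift[OF s(1) d] triangle_lift[OF s(2) d'] by (simp add: bdry_lift)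
  moreover have "norm (loop F p q r - - loop F p q r) = 2 * norm (loop F p q r)"
    by (metis diff_minus_eq_add norm_scaleR scaleR_2 abs_numeral)
  ultimately show "norm (loop F p q r) \<le> K * \<bar>det3 p q r\<bar> powr (\<alpha> / 2)"
    using norm_ge_zero[of "loop F p q r"] by linarith
qed

lemma three_pointD:
  assumes "three_point K" "norm (q - p) \<le> 1/4" "norm (r - p) \<le> 1/4"
    "norm (r - q) + sqrt \<bar>det3 p q r\<bar> \<le> x"
  shows "norm (F p q - F p r) \<le> K * x powr \<alpha>"
proof -
  have "norm (F p q - F p r) \<le> K * (norm (r - q) + sqrt \<bar>det3 p q r\<bar>) powr \<alpha>"
    using assms(1-3) by (simp add: three_point_def)
  also have "\<dots> \<le> K * x powr \<alpha>" using assms by (intro powr_le) (auto simp: three_point_def)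
  finally show ?thesis .
qed

text \<open>In a vee the chord is at most the square root of the determinant, so the area alone
  controls the three-point bound; the 3 bounds 2 * sqrt 2.\<close>

lemma three_point_imp_vee:
  assumes t: "three_point K"
  shows "vee_norm \<alpha> A \<le> ennreal (3 * K)"
  unfolding vee_norm_def
proof (rule SUP_quotient_leI)
  have K: "0 \<le> K" using t by (simp add: three_point_def)
  then show "0 \<le> 3 * K" by simp
  fix x assume "x \<in> {(l, l'). l \<in> Xsp \<and> l' \<in> Xsp \<and> l \<noteq> l' \<and> is_vee l l'}"
  then obtain l l' where x: "x = (l, l')" "l \<in> Xsp" "l' \<in> Xsp" "l \<noteq> l'" "is_vee l l'" by auto
  obtain p q r where v: "l = (wrap p, q - p)" "l' = (wrap p, r - p)" "norm (q - p) \<le> 1/4"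
    "norm (r - p) \<le> 1/4" "(norm (r - q))\<^sup>2 \<le> \<bar>det3 p q r\<bar>"
    using is_veeD[OF x(2,3,5,4)] by metis
  define a where "a = sqrt (\<bar>det3 p q r\<bar> / 2)"
  have a: "0 \<le> a" "sqrt \<bar>det3 p q r\<bar> = sqrt 2 * a" by (simp_all add: a_def real_sqrt_divide)
  have "norm (r - q) \<le> sqrt \<bar>det3 p q r\<bar>" using v(5) by (simp add: real_le_rsqrt)
  moreover have "sqrt 2 * a \<le> (3/2) * a" by (intro mult_right_mono real_le_lsqrt a(1)) (simp_all add: power2_eq_square)
  ultimately have "norm (r - q) + sqrt \<bar>det3 p q r\<bar> \<le> 3 * a" unfolding a(2) by linarith
  then have "norm (F p q - F p r) \<le> K * (3 * a) powr \<alpha>" by (intro three_pointD[OF t] v)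
  also have "\<dots> \<le> 3 * K * a powr \<alpha>" using a K by (intro powr_le_scale) auto
  also have "a powr \<alpha> = (\<bar>det3 p q r\<bar> / 2) powr (\<alpha> / 2)" by (simp add: a_def sqrt_powr)
  finally show "norm (A (fst x) - A (snd x)) \<le> 3 * K * seg_area (fst x) (snd x) powr (\<alpha> / 2)"
    by (simp add: x v F_def seg_area_common_start)
qed simp

end


subsection \<open>Estimates for boundary sums\<close>

lemma short_rotate: "short q r p \<longleftrightarrow> short p q r"
  by (auto simp: short_def)

context additive_functional
begin

text \<open>Cut the longest side at the foot of the altitude onto it; each of the two other sides is then compared
  with the piece it shares a vertex with.\<close>

lemma loop_bound_longest:
  assumes t: "three_point K" and s: "short p q r"
    and max: "norm (r - q) \<le> norm (q - p)" "norm (p - r) \<le> norm (q - p)"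
  shows "norm (loop F p q r) \<le> 4 * K * \<bar>det3 p q r\<bar> powr (\<alpha> / 2)"
proof (cases "q = p")
  case True
  then have "r = p" using max by simp
  then show ?thesis using True t by (simp add: loop_def three_point_def)
next
  case False
  have K: "0 \<le> K" using t by (simp add: three_point_def)
  define u where "u = q - p"
  define v where "v = r - p"
  have u: "0 < norm u" "0 < u \<bullet> u" using False by (simp_all add: u_def)
  define \<tau> where "\<tau> = (v \<bullet> u) / (u \<bullet> u)"
  define f where "f = p + \<tau> *\<^sub>R u"
  define w where "w = v - \<tau> *\<^sub>R u"
  have wu: "w \<bullet> u = 0" using u by (simp add: w_def \<tau>_def inner_diff_left)
  have rq: "r - q = v - u" by (simp add: u_def v_def)
  have "norm v \<le> norm u" using max(2) by (simp add: u_def v_def norm_minus_commute[of p r])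
  then have nv: "v \<bullet> v \<le> u \<bullet> u" by (simp add: norm_le)
  \<comment> \<open>As the other sides are no longer than \<open>u\<close>, the angles at
    \<open>p\<close> and \<open>q\<close> are not obtuse, so the foot \<open>f\<close> lies on the
    side: \<tau> is in [0, 1].\<close>
  have "(v - u) \<bullet> (v - u) \<le> u \<bullet> u" using max(1) unfolding rq by (simp add: u_def norm_le)
  then have "v \<bullet> v \<le> 2 * (v \<bullet> u)" by (simp add: inner_diff inner_commute)
  then have "0 \<le> v \<bullet> u" using inner_ge_zero[of v] by linarith
  moreover have "v \<bullet> u \<le> u \<bullet> u"
  proof -
    have "2 * (v \<bullet> u) \<le> v \<bullet> v + u \<bullet> u"
      using inner_ge_zero[of "v - u"] by (simp add: inner_diff inner_commute)
    then show ?thesis using nv by linarith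
  qed
  ultimately have \<tau>: "0 \<le> \<tau>" "\<tau> \<le> 1" using u by (simp_all add: \<tau>_def)
  have v: "v = \<tau> *\<^sub>R u + w" by (simp add: w_def)
  have "v \<bullet> v = \<tau>\<^sup>2 * (u \<bullet> u) + w \<bullet> w"
    unfolding v using wu by (simp add: inner_add inner_commute power2_eq_square)
  moreover have "0 \<le> \<tau>\<^sup>2 * (u \<bullet> u)" by simp
  ultimately have "w \<bullet> w \<le> u \<bullet> u" using nv by linarith
  then have wn: "norm w \<le> norm u" by (simp add: norm_le)
  define d where "d = \<bar>det3 p q r\<bar>"
  have "det3 p q r = cross2 u w" by (simp add: w_def u_def v_def det3_coord algebra_simps)
  moreover have "(cross2 u w)\<^sup>2 = (norm u * norm w)\<^sup>2"
    using cross2_sq[of u w] wu by (simp add: inner_commute power_mult_distrib)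
  ultimately have d: "d = norm u * norm w"
    unfolding d_def by (auto simp: power2_eq_iff abs_mult)
  \<comment> \<open>The reason for cutting the longest side: the altitude is at most the base, hence
    at most the square root of their product, and the length term of \<open>three_point\<close> is
    absorbed by the area.\<close>
  then have "norm w * norm w \<le> d" using wn by (simp add: mult_right_mono)
  then have wd: "norm w \<le> sqrt d" by (simp add: real_le_rsqrt power2_eq_square)
  have fp: "f - p = \<tau> *\<^sub>R u" and fq: "f - q = (\<tau> - 1) *\<^sub>R u" and fr: "r - f = w"
    by (simp_all add: f_def w_def u_def v_def algebra_simps)
  have nfp: "norm (f - p) \<le> norm u" and nfq: "norm (f - q) \<le> norm u"
    unfolding fp fq using \<tau> u by (simp_all add: mult_left_le_one_le)
  have su: "norm u \<le> 1/4" "norm v \<le> 1/4" "norm (r - q) \<le> 1/4"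
    using s by (simp_all add: short_def u_def v_def norm_minus_commute)
  have b: "norm (F x f - F x r) \<le> 2 * K * sqrt d powr \<alpha>"
    if x: "norm (f - x) \<le> norm u" "norm (r - x) \<le> 1/4" "\<bar>det3 x f r\<bar> \<le> d" for x
  proof -
    have "sqrt \<bar>det3 x f r\<bar> \<le> sqrt d" using x(3) by (rule real_sqrt_le_mono)
    then have "norm (r - f) + sqrt \<bar>det3 x f r\<bar> \<le> 2 * sqrt d" unfolding fr using wd by linarith
    then have "norm (F x f - F x r) \<le> K * (2 * sqrt d) powr \<alpha>"
      using x su by (intro three_pointD[OF t]) auto
    also have "\<dots> \<le> 2 * K * sqrt d powr \<alpha>"
      using K by (intro powr_le_scale) (auto simp: d_def)
    finally show ?thesis .
  qed
  have "det3 p f r = \<tau> * det3 p q r" "det3 q f r = (\<tau> - 1) * det3 p q r"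
    by (simp_all add: f_def u_def det3_coord algebra_simps)
  then have "\<bar>det3 p f r\<bar> \<le> d" "\<bar>det3 q f r\<bar> \<le> d"
    using \<tau> by (simp_all add: d_def abs_mult mult_left_le_one_le)
  then have 1: "norm (F p f - F p r) \<le> 2 * K * sqrt d powr \<alpha>"
    and 2: "norm (F q f - F q r) \<le> 2 * K * sqrt d powr \<alpha>"
    using su nfp nfq by (auto intro!: b simp: v_def)
  have "F p q = F p f + F f q"
  proof (rule F_collinear)
    show "f = p + \<tau> *\<^sub>R (q - p)" by (simp add: f_def u_def)
  qed (use nfp nfq su in \<open>auto simp: norm_minus_commute u_def\<close>)
  moreover have "F f q = - F q f" using nfq su by (intro F_anti) simp
  moreover have "F r p = - F p r" using su by (intro F_anti) (simp add: v_def)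
  ultimately have eq: "loop F p q r = (F p f - F p r) - (F q f - F q r)" by (simp add: loop_def)
  have "sqrt d powr \<alpha> = \<bar>det3 p q r\<bar> powr (\<alpha> / 2)" by (simp add: d_def sqrt_powr)
  then show ?thesis
    unfolding eq using 1 2 norm_triangle_ineq4[of "F p f - F p r" "F q f - F q r"] by simp
qed

lemma loop_bound:
  assumes t: "three_point K" and s: "short p q r"
  shows "norm (loop F p q r) \<le> 4 * K * \<bar>det3 p q r\<bar> powr (\<alpha> / 2)"
proof -
  consider "norm (r - q) \<le> norm (q - p)" "norm (p - r) \<le> norm (q - p)"
    | "norm (p - r) \<le> norm (r - q)" "norm (q - p) \<le> norm (r - q)"
    | "norm (q - p) \<le> norm (p - r)" "norm (r - q) \<le> norm (p - r)"
    by linarith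
  then show ?thesis
  proof cases
    case 1
    then show ?thesis by (intro loop_bound_longest t s)
  next
    case 2
    then show ?thesis
      using loop_bound_longest[OF t, of q r p] s det3_rotate[of q r p] loop_rotate[of F q r p]
      by (simp add: short_rotate)
  next
    case 3
    then show ?thesis
      using loop_bound_longest[OF t, of r p q] s det3_rotate[of p q r] loop_rotate[of F p q r]
      by (simp add: short_rotate[of p q r])
  qed
qed

text \<open>Two overlapping triangles of diameter at most 1/4 have vertices at distance up to 1/2, where \<open>F\<close> carries
  no information; so it is extended by halving segments.\<close>

definition F_ext :: "pt \<Rightarrow> pt \<Rightarrow> 'e" where
  "F_ext p q = (if norm (q - p) \<le> 1/2 then F p (midpoint p q) + F (midpoint p q) q else 0)"

lemma midpoint_diff:
  "midpoint p q - p = (1/2) *\<^sub>R (q - p)" "q - midpoint p q = (1/2) *\<^sub>R (q - p)"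
  for p q :: pt
  by (simp_all add: midpoint_def vec_eq_iff field_simps)

text \<open>Holds at every distance, as \<open>loop_symm_bound\<close> asks: the default value 0 is
  its own negative.\<close>

lemma F_ext_anti: "F_ext q p = - F_ext p q"
proof (cases "norm (q - p) \<le> 1/2")
  case True
  let ?m = "midpoint p q"
  have "F q ?m = - F ?m q" "F ?m p = - F p ?m"
    using True by (auto intro!: F_anti simp: midpoint_diff norm_minus_commute[of ?m q])
  then show ?thesis using True by (simp add: F_ext_def midpoint_sym[of q p] norm_minus_commute[of p q])
qed (simp add: F_ext_def norm_minus_commute)

lemma F_ext_eq: "norm (q - p) \<le> 1/4 \<Longrightarrow> F_ext p q = F p q"
  unfolding F_ext_def
  by (subst F_collinear[of "midpoint p q" p "1/2" q])
    (auto simp: midpoint_diff, simp add: midpoint_def algebra_simps vec_eq_iff)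

text \<open>The medial triangle cuts \<open>p q r\<close> into four triangles with sides at most 1/4
  and a quarter of the area. Inner edges cancel, so the four loops add up; 16 = 4 * 4.\<close>

lemma loop_F_ext_bound:
  assumes t: "three_point K"
    and s: "norm (q - p) \<le> 1/2" "norm (r - q) \<le> 1/2" "norm (p - r) \<le> 1/2"
  shows "norm (loop F_ext p q r) \<le> 16 * K * \<bar>det3 p q r\<bar> powr (\<alpha> / 2)"
proof -
  have K: "0 \<le> K" using t by (simp add: three_point_def)
  define a b c where "a = midpoint p q" and "b = midpoint q r" and "c = midpoint r p"
  have e: "a - p = (1/2) *\<^sub>R (q - p)" "q - a = (1/2) *\<^sub>R (q - p)" "b - q = (1/2) *\<^sub>R (r - q)"
    "r - b = (1/2) *\<^sub>R (r - q)" "c - r = (1/2) *\<^sub>R (p - r)" "p - c = (1/2) *\<^sub>R (p - r)"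
    "b - a = (1/2) *\<^sub>R (r - p)" "c - b = (1/2) *\<^sub>R (p - q)" "a - c = (1/2) *\<^sub>R (q - r)"
    by (simp_all add: a_def b_def c_def midpoint_def vec_eq_iff field_simps)
  have n: "norm (q - p) \<le> 1/2" "norm (p - q) \<le> 1/2" "norm (r - q) \<le> 1/2" "norm (q - r) \<le> 1/2"
    "norm (p - r) \<le> 1/2" "norm (r - p) \<le> 1/2" using s by (simp_all add: norm_minus_commute)
  have n': "norm ((1/2) *\<^sub>R x) \<le> 1/4" if "norm x \<le> 1/2" for x :: pt using that by simp
  have sh: "short p a c" "short a q b" "short b r c" "short a b c"
    using n' n e unfolding short_def
    by (metis norm_minus_commute)+
  have de: "det3 p a c = det3 p q r / 4" "det3 a q b = det3 p q r / 4" "det3 b r c = det3 p q r / 4"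
    "det3 a b c = det3 p q r / 4"
    by (simp_all add: a_def b_def c_def midpoint_def det3_coord field_simps)
  have bd: "norm (loop F x y z) \<le> 4 * K * \<bar>det3 p q r\<bar> powr (\<alpha> / 2)"
    if "short x y z" "det3 x y z = det3 p q r / 4" for x y z
  proof -
    have "norm (loop F x y z) \<le> 4 * K * \<bar>det3 p q r / 4\<bar> powr (\<alpha> / 2)"
      using loop_bound[OF t that(1)] that(2) by simp
    also have "\<dots> \<le> 4 * K * \<bar>det3 p q r\<bar> powr (\<alpha> / 2)"
      using K \<alpha> by (intro mult_left_mono powr_mono2) auto
    finally show ?thesis .
  qed
  have anti: "F c a = - F a c" "F b a = - F a b" "F c b = - F b c"
    using n' n e by (auto intro!: F_anti simp: norm_minus_commute[of c a] norm_minus_commute[of b a] norm_minus_commute[of c b])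
  have "loop F_ext p q r = loop F p a c + loop F a q b + loop F b r c + loop F a b c"
    using s anti by (simp add: loop_def F_ext_def a_def[symmetric] b_def[symmetric] c_def[symmetric] ac_simps)
  also have "norm \<dots> \<le> norm (loop F p a c) + norm (loop F a q b) + norm (loop F b r c) + norm (loop F a b c)"
    by (intro order_trans[OF norm_triangle_ineq] add_right_mono order_refl)
  also have "\<dots> \<le> 16 * K * \<bar>det3 p q r\<bar> powr (\<alpha> / 2)"
    using bd[OF sh(1) de(1)] bd[OF sh(2) de(2)] bd[OF sh(3) de(3)] bd[OF sh(4) de(4)] by linarith
  finally show ?thesis .
qed

end

section \<open>Comparison of two triangles on the torus\<close>

lemma lmeasurable_tri_int: "short p q r \<Longrightarrow> tri_int (lift_tri p q r) \<in> lmeasurable"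
proof -
  assume s: "short p q r"
  have "inj_on wrap (interior (convex hull {p, q, r}))"
    using short_hull[OF s] interior_subset[of "convex hull {p, q, r}"] by (intro inj_on_wrap) force
  then show ?thesis
    unfolding tri_int_lift
    by (intro lmeasurable_wrap_image lmeasurable_interior bounded_convex_hull finite_imp_bounded)
      simp_all
qed

lemma det3_nonzero_of_interior: "x \<in> interior (convex hull {p, q, r}) \<Longrightarrow> det3 p q r \<noteq> 0"
proof
  assume x: "x \<in> interior (convex hull {p, q, r})" and "det3 p q r = 0"
  then have "measure lebesgue (interior (convex hull {p, q, r})) = 0"
    by (simp only: measure_interior_hull finite.intros measure_triangle)
  moreover have "interior (convex hull {p, q, r}) \<in> lmeasurable"
    by (intro lmeasurable_interior bounded_convex_hull finite_imp_bounded) simp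
  ultimately have "negligible (interior (convex hull {p, q, r}))"
    using negligible_iff_measure by blast
  then show False using x open_not_negligible[OF open_interior] by blast
qed

context additive_functional
begin

lemma loop_le_tri_area:
  assumes t: "three_point K" and s: "short p q r"
  shows "norm (loop F p q r) \<le> 8 * K * tri_area (lift_tri p q r) powr (\<alpha> / 2)"
proof -
  have K: "0 \<le> K" using t by (simp add: three_point_def)
  have "norm (loop F p q r) \<le> 4 * K * (2 * tri_area (lift_tri p q r)) powr (\<alpha> / 2)"
    using loop_bound[OF t s] by (simp add: tri_area_lift[OF s])
  also have "\<dots> \<le> 4 * K * (2 * tri_area (lift_tri p q r) powr (\<alpha> / 2))"
    using K \<alpha> by (intro mult_left_mono powr_scale_le) (auto simp: tri_area_lift[OF s])
  finally show ?thesis by simp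
qed

lemma three_point_imp_tri:
  assumes t: "three_point K"
  shows "tri_norm \<alpha> A \<le> ennreal (8 * K)"
  unfolding tri_norm_def
proof (rule SUP_quotient_leI)
  show "0 \<le> 8 * K" using t by (simp add: three_point_def)
  fix P assume "P \<in> {P. triangle P \<and> 0 < tri_area P}"
  then obtain p q r where "P = lift_tri p q r" "short p q r" by (auto elim: triangleE)
  then show "norm (bdry A P) \<le> 8 * K * tri_area P powr (\<alpha> / 2)"
    using loop_le_tri_area[OF t] by (simp add: bdry_lift)
qed simp

text \<open>All points of both triangles are within 1/4 of the common point, hence within 1/2 of
  each other. So \<open>wrap\<close> is injective on the union of the interiors, the symmetric
  difference has the same measure in the plane and on the torus, and \<open>F_ext\<close> covers all
  pairs of vertices. The constant is 9000 * 16.\<close>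

lemma overlapping_triangles:
  assumes t: "three_point K" and s: "short a b c" "short a' b' c'"
    and x: "x \<in> interior (convex hull {a, b, c})" "x \<in> interior (convex hull {a', b', c'})"
    and D: "0 < det3 a b c * det3 a' b' c'"
    and S: "0 < tri_dist (lift_tri a b c) (lift_tri a' b' c')"
  shows "norm (loop F a b c - loop F a' b' c') \<le>
    144000 * K * tri_dist (lift_tri a b c) (lift_tri a' b' c') powr (\<alpha> / 2)"
proof -
  define T T' where "T = convex hull {a, b, c}" and "T' = convex hull {a', b', c'}"
  define d where "d = tri_dist (lift_tri a b c) (lift_tri a' b' c')"
  have K: "0 \<le> K" using t by (simp add: three_point_def)
  have xT: "x \<in> T" "x \<in> T'" using x interior_subset by (auto simp: T_def T'_def)
  have near: "norm (y - x) \<le> 1/4" "norm (x - y) \<le> 1/4" if "y \<in> T \<union> T'" for y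
    using that xT short_hull[OF s(1)] short_hull[OF s(2)] by (auto simp: T_def T'_def)
  have half: "norm (y - z) \<le> 1/2" if "y \<in> T \<union> T'" "z \<in> T \<union> T'" for y z
    using near(1)[OF that(1)] near(2)[OF that(2)] norm_triangle_ineq[of "y - x" "x - z"] by simp
  have conv: "convex T" "compact T" "convex T'" "compact T'"
    by (auto simp: T_def T'_def intro!: finite_imp_compact_convex_hull)
  define I I' where "I = interior T" and "I' = interior T'"
  have II: "I \<subseteq> T" "I' \<subseteq> T'" "I \<in> lmeasurable" "I' \<in> lmeasurable"
    using conv by (auto simp: I_def I'_def interior_subset compact_imp_bounded intro!: lmeasurable_interior)
  have inj: "inj_on wrap (I \<union> I')"
  proof (rule inj_on_wrap)
    fix y z assume "y \<in> I \<union> I'" "z \<in> I \<union> I'"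
    then have "y \<in> T \<union> T'" "z \<in> T \<union> T'" using II(1,2) by auto
    then show "norm (y - z) < 1" using half[of y z] by linarith
  qed
  have "sgn (det3 a b c) = sgn (det3 a' b' c')"
    using D by (auto simp: sgn_if zero_less_mult_iff)
  then have "d = measure lebesgue ((wrap ` I - wrap ` I') \<union> (wrap ` I' - wrap ` I))"
    by (simp add: d_def tri_dist_def tri_orient_lift tri_int_lift I_def I'_def T_def T'_def)
  also have "(wrap ` I - wrap ` I') \<union> (wrap ` I' - wrap ` I) = wrap ` ((I - I') \<union> (I' - I))"
  proof -
    have "I - I' \<subseteq> I \<union> I'" "I' - I \<subseteq> I \<union> I'" by blast+
    then show ?thesis
      by (simp add: image_Un inj_on_image_set_diff[OF inj])
  qed
  also have "measure lebesgue \<dots> = measure lebesgue ((I - I') \<union> (I' - I))"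
    using II by (intro measure_wrap_image inj_on_subset[OF inj]) (auto intro: fmeasurableD)
  finally have d: "d = measure lebesgue ((I - I') \<union> (I' - I))" .
  have "measure lebesgue (I - I') \<le> d" "measure lebesgue (I' - I) \<le> d"
    unfolding d using II
    by (auto intro!: measure_mono_fmeasurable intro: fmeasurable_Diff fmeasurable.Un fmeasurableD)
  then have m: "measure lebesgue (T - T') \<le> d" "measure lebesgue (T' - T) \<le> d"
    using measure_Diff_interior_le conv by (auto simp: I_def I'_def intro: order_trans)
  define V where "V = {a, b, c, a', b', c'}"
  have VT: "V \<subseteq> T \<union> T'" by (auto simp: V_def T_def T'_def hull_inc)
  have bd: "norm (loop F_ext y z w) \<le> (16 * K) * \<bar>det3 y z w\<bar> powr (\<alpha> / 2)"
    if "y \<in> V" "z \<in> V" "w \<in> V" for y z w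
    using loop_F_ext_bound[OF t] half that VT by blast
  have "norm (loop F_ext a b c - loop F_ext a' b' c') \<le> 9000 * (16 * K) * d powr (\<alpha> / 2)"
  proof (rule loop_symm_bound[of F_ext "16 * K" "\<alpha> / 2" V, OF F_ext_anti _ _ _ bd _ D])
    show "{a, b, c, a', b', c'} \<subseteq> V" by (simp add: V_def)
  qed (use K \<alpha> S m in \<open>simp_all add: d_def T_def T'_def\<close>)
  moreover have "loop F_ext a b c = loop F a b c" "loop F_ext a' b' c' = loop F a' b' c'"
    using s by (simp_all add: loop_def F_ext_eq short_def)
  ultimately show ?thesis by (simp add: d_def)
qed

lemma three_point_imp_symm:
  assumes t: "three_point K"
  shows "symm_norm \<alpha> A \<le> ennreal (144000 * K)"
  unfolding symm_norm_def
proof (rule SUP_quotient_leI)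
  have K: "0 \<le> K" using t by (simp add: three_point_def)
  then show "0 \<le> 144000 * K" by simp
  fix PP assume "PP \<in> {(P, Q). triangle P \<and> triangle Q \<and> 0 < tri_dist P Q}"
  then obtain P Q where PQ: "PP = (P, Q)" "triangle P" "triangle Q" "0 < tri_dist P Q" by auto
  obtain a b c where P: "P = lift_tri a b c" "short a b c" using PQ(2) by (rule triangleE)
  obtain a' b' c' where Q: "Q = lift_tri a' b' c'" "short a' b' c'" using PQ(3) by (rule triangleE)
  define d where "d = tri_dist P Q"
  have d: "0 < d" "0 \<le> K * d powr (\<alpha> / 2)" using PQ(4) K by (simp_all add: d_def)
  \<comment> \<open>When the distance dominates each area, the loops are bounded separately. This
    settles opposite orientations and disjoint interiors.\<close>
  have trivial: "norm (bdry A P - bdry A Q) \<le> 144000 * K * d powr (\<alpha> / 2)"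
    if "tri_area P \<le> d" "tri_area Q \<le> d"
  proof -
    have "norm (bdry A R) \<le> 8 * K * d powr (\<alpha> / 2)"
      if R: "R = lift_tri u v w" "short u v w" "tri_area R \<le> d" for R u v w
    proof -
      have "norm (bdry A R) \<le> 8 * K * tri_area R powr (\<alpha> / 2)"
        using loop_le_tri_area[OF t R(2)] by (simp add: R bdry_lift)
      also have "\<dots> \<le> 8 * K * d powr (\<alpha> / 2)"
        using R K \<alpha> by (intro mult_left_mono powr_mono2) (auto simp: tri_area_lift)
      finally show ?thesis .
    qed
    from this[OF P that(1)] this[OF Q that(2)] show ?thesis
      using d norm_triangle_ineq4[of "bdry A P" "bdry A Q"] by linarith
  qed
  show "norm (bdry A (fst PP) - bdry A (snd PP)) \<le> 144000 * K * tri_dist (fst PP) (snd PP) powr (\<alpha> / 2)"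
    unfolding PQ(1) fst_conv snd_conv d_def[symmetric]
  proof (cases "tri_orient P = tri_orient Q")
    case False
    then have "d = tri_area P + tri_area Q" by (simp add: d_def tri_dist_def)
    then show "norm (bdry A P - bdry A Q) \<le> 144000 * K * d powr (\<alpha> / 2)"
      by (intro trivial) (simp_all add: tri_area_def)
  next
    case same: True
    have meas: "tri_int P \<in> lmeasurable" "tri_int Q \<in> lmeasurable"
      using P Q by (simp_all add: lmeasurable_tri_int)
    have dd: "d = measure lebesgue ((tri_int P - tri_int Q) \<union> (tri_int Q - tri_int P))"
      using same by (simp add: d_def tri_dist_def)
    show "norm (bdry A P - bdry A Q) \<le> 144000 * K * d powr (\<alpha> / 2)"
    proof (cases "tri_int P \<inter> tri_int Q = {}")
      case True
      then have "d = measure lebesgue (tri_int P \<union> tri_int Q)"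
        unfolding dd by (metis Diff_triv Int_commute)
      then show ?thesis
        using meas by (intro trivial)
          (auto simp: tri_area_def intro!: measure_mono_fmeasurable intro: fmeasurable.Un fmeasurableD)
    next
      case False
      then obtain x y where xy: "x \<in> interior (convex hull {a, b, c})"
        "y \<in> interior (convex hull {a', b', c'})" "wrap x = wrap y"
        unfolding P Q tri_int_lift by blast
      \<comment> \<open>The chosen lifts meet only modulo the lattice; translating the second by
        \<open>k\<close> gives the planar triangles a common interior point.\<close>
      define k where "k = x - y"
      have "int_vec k" using xy(3) by (simp add: k_def wrap_eq_iff)
      then have Q': "Q = lift_tri (a' + k) (b' + k) (c' + k)" by (simp add: Q lift_tri_shift)
      have s': "short (a' + k) (b' + k) (c' + k)" using Q(2) by (simp add: short_def)
      have "convex hull {a' + k, b' + k, c' + k} = (+) k ` (convex hull {a', b', c'})"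
        unfolding convex_hull_translation[symmetric] by (simp add: add.commute)
      then have x': "x \<in> interior (convex hull {a' + k, b' + k, c' + k})"
        using xy(2) by (auto simp: interior_translation k_def image_iff intro!: bexI[of _ y])
      have "det3 a b c \<noteq> 0" "det3 (a' + k) (b' + k) (c' + k) \<noteq> 0"
        using det3_nonzero_of_interior xy(1) x' by blast+
      moreover have "sgn (det3 a b c) = sgn (det3 (a' + k) (b' + k) (c' + k))"
        using same by (simp only: P Q' tri_orient_lift)
      ultimately have "0 < det3 a b c * det3 (a' + k) (b' + k) (c' + k)"
        by (auto simp: sgn_if zero_less_mult_iff split: if_splits)
      then show ?thesis
        using overlapping_triangles[OF t P(2) s' xy(1) x'] d
        by (simp add: d_def P(1) Q' bdry_lift)
    qed
  qed
qed simp

end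


subsection \<open>Equivalence of the norms\<close>

context additive_functional
begin

text \<open>The diagonal from \<open>p\<close> to the second midpoint has length at most 1/16 + 1/8,
  so \<open>F\<close> is controlled on it. Two comparisons, with common end first \<open>p\<close>
  and then that midpoint, cost 2 + 2.\<close>

lemma half_segments_bound:
  assumes t: "three_point K"
    and n: "norm (q - p) \<le> 1/4" "norm (q' - p') \<le> 1/4" "norm (p' - p) \<le> 1/16"
    and x: "x = norm (p' - p) + norm (q' - q) + sqrt (measure lebesgue (convex hull {p, q, q', p'}))"
  shows "norm (F p (midpoint p q) - F p' (midpoint p' q')) \<le> 4 * K * x powr \<alpha>"
proof -
  have K: "0 \<le> K" using t by (simp add: three_point_def)
  define H where "H = convex hull {p, q, q', p'}"
  define m m' where "m = midpoint p q" and "m' = midpoint p' q'"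
  define \<mu> where "\<mu> = sqrt (measure lebesgue H)"
  have \<mu>: "0 \<le> \<mu>" and x': "x = norm (p' - p) + norm (q' - q) + \<mu>"
    by (simp_all add: \<mu>_def x H_def)
  have e: "m - p = (1/2) *\<^sub>R (q - p)" "m' - p' = (1/2) *\<^sub>R (q' - p')"
    "m' - m = (1/2) *\<^sub>R ((p' - p) + (q' - q))" "m' - p = (p' - p) + (1/2) *\<^sub>R (q' - p')"
    by (simp_all add: m_def m'_def midpoint_def vec_eq_iff field_simps)
  have nm: "norm (m - p) \<le> 1/4" "norm (m' - p') \<le> 1/4" using n by (simp_all add: e)
  have nm': "norm (m' - p) \<le> 1/4"
    unfolding e using norm_triangle_ineq[of "p' - p" "(1/2) *\<^sub>R (q' - p')"] n by simp
  have "norm (m' - m) \<le> (norm (p' - p) + norm (q' - q)) / 2"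
    unfolding e using norm_triangle_ineq[of "p' - p" "q' - q"] by simp
  also have "\<dots> \<le> norm (p' - p) + norm (q' - q)" by simp
  finally have nmm: "norm (m' - m) \<le> norm (p' - p) + norm (q' - q)" .
  have H: "convex H" "p \<in> H" "q \<in> H" "p' \<in> H" "q' \<in> H" "H \<in> lmeasurable"
    by (auto simp: H_def hull_inc intro!: lmeasurable_compact finite_imp_compact_convex_hull)
  then have mH: "m \<in> H" "m' \<in> H"
    using convexD_alt[of H p q "1/2"] convexD_alt[of H p' q' "1/2"]
    by (simp_all add: m_def m'_def midpoint_def algebra_simps)
  have det: "sqrt \<bar>det3 y z w\<bar> \<le> 2 * \<mu>" if "y \<in> H" "z \<in> H" "w \<in> H" for y z w
  proof -
    have "measure lebesgue (convex hull {y, z, w}) \<le> measure lebesgue H"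
      using that H by (intro measure_mono_fmeasurable hull_minimal)
        (auto intro!: fmeasurableD lmeasurable_compact finite_imp_compact_convex_hull)
    then have "\<bar>det3 y z w\<bar> \<le> 4 * measure lebesgue H"
      unfolding measure_triangle using measure_nonneg[of lebesgue H] by linarith
    then have "sqrt \<bar>det3 y z w\<bar> \<le> sqrt (4 * measure lebesgue H)" by (rule real_sqrt_le_mono)
    then show ?thesis unfolding \<mu>_def by (simp add: real_sqrt_mult)
  qed
  have "0 \<le> x" using \<mu> by (simp add: x')
  have b: "K * (2 * x) powr \<alpha> \<le> 2 * K * x powr \<alpha>"
    using K \<open>0 \<le> x\<close> by (intro powr_le_scale) auto
  have "norm (F p m - F p m') \<le> K * (2 * x) powr \<alpha>"
  proof (intro three_pointD[OF t] nm nm')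
    show "norm (m' - m) + sqrt \<bar>det3 p m m'\<bar> \<le> 2 * x"
      using det[OF H(2) mH] nmm \<mu> norm_ge_zero[of "p' - p"] norm_ge_zero[of "q' - q"]
      unfolding x' by argo
  qed
  moreover have "norm (F m' p - F m' p') \<le> K * (2 * x) powr \<alpha>"
  proof (intro three_pointD[OF t])
    show "norm (p' - p) + sqrt \<bar>det3 m' p p'\<bar> \<le> 2 * x"
      using det[OF mH(2) H(2,4)] \<mu> norm_ge_zero[of "p' - p"] norm_ge_zero[of "q' - q"]
      unfolding x' by argo
  qed (use nm nm' in \<open>simp_all add: norm_minus_commute\<close>)
  moreover have eq: "F p m - F p' m' = (F p m - F p m') - (F m' p - F m' p')"
    using F_anti[OF nm(2)] F_anti[OF nm'] by simp
  ultimately show ?thesis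
    unfolding m_def[symmetric] m'_def[symmetric] eq
    using b norm_triangle_ineq4[of "F p m - F p m'" "F m' p - F m' p'"] by linarith
qed

text \<open>A segment is the difference of the two half segments running from its ends to its
  midpoint. The estimate for halves is used once from the initial and once from the final points, at
  cost 4 + 4.\<close>

lemma three_point_imp_hol:
  assumes t: "three_point K" and g: "growth K"
  shows "hol_norm \<alpha> A \<le> ennreal (8 * K)"
  unfolding hol_norm_def
proof (rule SUP_quotient_leI)
  have K: "0 \<le> K" using t by (simp add: three_point_def)
  then show "0 \<le> 8 * K" by simp
  fix ll assume "ll \<in> {(l, l'). l \<in> Xsp \<and> l' \<in> Xsp \<and> 0 < rho l l'}"
  then obtain l l' where ll: "ll = (l, l')" "l \<in> Xsp" "l' \<in> Xsp" "0 < rho l l'" by auto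
  define R where "R = rho l l'"
  have nn: "0 \<le> K * R powr \<alpha>" using K by simp
  have "norm (A l - A l') \<le> 8 * K * R powr \<alpha>"
  proof (cases "far l l'")
    case True
    then have "seg_len l \<le> R" "seg_len l' \<le> R" by (simp_all add: R_def rho_def seg_len_def)
    then have "norm (A l) \<le> K * R powr \<alpha>" "norm (A l') \<le> K * R powr \<alpha>"
      using ll by (auto intro: norm_A_le[OF g])
    then show ?thesis using norm_triangle_ineq4[of "A l" "A l'"] nn by linarith
  next
    case False
    obtain p v p1 v' where l: "l = (p, v)" "l' = (p1, v')" by (meson surj_pair)
    have X: "p \<in> torus" "p1 \<in> torus" "norm v \<le> 1/4" "norm v' \<le> 1/4"
      using ll by (simp_all add: l Xsp_def)
    \<comment> \<open>The same representative as in \<open>seg_area\<close>, so that the hull there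
      is a translate of the planar one.\<close>
    define p' where "p' = p + wrap (p1 - p)"
    define q q' where "q = p + v" and "q' = p' + v'"
    have pp1: "wrap p' = p1"
      using wrap_wrap_add[of "p1 - p" p] wrap_torus[OF X(2)] by (simp add: p'_def add.commute)
    have A: "A l = F p q" "A l' = F p' q'"
      using X(1) pp1 by (simp_all add: l F_def q_def q'_def wrap_torus)
    have "max (tdist p p1) (tdist (wrap (p + v)) (wrap (p1 + v'))) \<le> 1/4 * min (norm v) (norm v')"
      using False by (simp only: far_def l seg_i_def seg_f_def seg_len_def fst_conv snd_conv not_less)
    then have f: "tdist p p1 \<le> norm v / 4" "tdist (wrap (p + v)) (wrap (p1 + v')) \<le> norm v / 4"
      by linarith+
    have d: "norm (p' - p) = tdist p1 p" by (simp add: p'_def tdist_def)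
    \<comment> \<open>\<open>wrap\<close> is not odd where a coordinate is -1/2, but it is on short
      differences.\<close>
    have sym: "tdist x y = tdist y x" if "norm (wrap (x - y)) \<le> 1/16" for x y
    proof -
      define z where "z = wrap (x - y)"
      have "y - x - (- z) = - ((x - y) - wrap (x - y))" by (simp add: z_def)
      then have "wrap (y - x) = wrap (- z)"
        unfolding wrap_eq_iff by (metis int_vec_simps(2) int_vec_wrap_diff)
      also have "\<dots> = - z" using that by (intro wrap_small) (simp add: z_def)
      finally show ?thesis by (simp add: tdist_def z_def)
    qed
    have d': "norm (p' - p) = tdist p p1" "norm (p' - p) \<le> 1/16"
      using sym[of p p1] f X d by (simp_all add: tdist_def)
    have fin: "norm (wrap (q - q')) = tdist (wrap (p + v)) (wrap (p1 + v'))"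
    proof -
      have "wrap q' = wrap (p1 + v')"
        unfolding q'_def pp1[symmetric] by simp
      then show ?thesis unfolding tdist_def q_def by (metis wrap_diff_wrap wrap_wrap)
    qed
    have "norm (q - q') \<le> norm v + norm (p' - p) + norm v'"
      using norm_triangle_ineq4[of "v - (p' - p)" v'] norm_triangle_ineq4[of v "p' - p"]
      by (simp add: q_def q'_def algebra_simps)
    then have "wrap (q - q') = q - q'"
      using fin f X d' by (intro wrap_eq_self) linarith
    then have e: "norm (q' - q) = tdist (seg_f l) (seg_f l')"
      using fin by (simp add: l seg_f_def norm_minus_commute)
    have "convex hull {p, q, q', p'} = (+) p ` (convex hull {0, v, wrap (p1 - p) + v', wrap (p1 - p)})"
      unfolding convex_hull_translation[symmetric] by (simp add: q_def q'_def p'_def add.assoc)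
    then have area: "measure lebesgue (convex hull {p, q, q', p'}) = seg_area l l'"
      by (simp only: seg_area_def l fst_conv snd_conv Let_def measure_translation)
    have R: "R = norm (p' - p) + norm (q' - q) + sqrt (measure lebesgue (convex hull {p, q, q', p'}))"
      unfolding R_def rho_def area e d'(1) using False by (simp add: l seg_i_def)
    have s: "norm (q - p) \<le> 1/4" "norm (q' - p') \<le> 1/4" using X by (simp_all add: q_def q'_def)
    have qq: "norm (q' - q) \<le> 1/16" using e f X by (simp add: l seg_f_def)
    have set: "{q, p, p', q'} = {p, q, q', p'}" by auto
    let ?m = "midpoint p q" and ?m' = "midpoint p' q'"
    have 1: "norm (F p ?m - F p' ?m') \<le> 4 * K * R powr \<alpha>"
      by (rule half_segments_bound[OF t s d'(2) R])
    have 2: "norm (F q ?m - F q' ?m') \<le> 4 * K * R powr \<alpha>"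
      using half_segments_bound[OF t _ _ qq, of p p' R] s R unfolding set
      by (simp add: norm_minus_commute midpoint_sym add.commute)
    have split: "F y z = F y (midpoint y z) - F z (midpoint y z)" if "norm (z - y) \<le> 1/4" for y z
    proof -
      have "F y z = F y (midpoint y z) + F (midpoint y z) z"
        using F_ext_eq[OF that] that by (simp add: F_ext_def)
      moreover have "F z (midpoint y z) = - F (midpoint y z) z"
        using that by (intro F_anti) (simp add: midpoint_diff)
      ultimately show ?thesis by simp
    qed
    have eq: "A l - A l' = (F p ?m - F p' ?m') - (F q ?m - F q' ?m')"
      unfolding A by (subst (1 2) split) (use s in simp_all)
    show ?thesis
      unfolding eq
      using 1 2 norm_triangle_ineq4[of "F p ?m - F p' ?m'" "F q ?m - F q' ?m'"] by linarith
  qed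
  then show "norm (A (fst ll) - A (snd ll)) \<le> 8 * K * rho (fst ll) (snd ll) powr \<alpha>"
    by (simp add: ll R_def)
qed (simp)

lemma growth_three_point_imp_hol:
  assumes g: "growth K" and t: "three_point (18 * K)"
  shows "hol_norm \<alpha> A \<le> ennreal (144 * K)"
  using three_point_imp_hol[OF t growth_mono[OF g]] g by (simp add: growth_def)

section \<open>From bounds by a constant to inequalities between norms\<close>

text \<open>\<open>X\<close> stands for any of the three norms. A finite sum bounds both summands by
  the same \<open>K\<close>; an infinite one leaves nothing to show. The constant is 8 * 18.\<close>

lemma hol_le_gr_plus:
  assumes X: "\<And>K. growth K \<Longrightarrow> X \<le> ennreal K \<Longrightarrow> three_point (18 * K)"
  shows "hol_norm \<alpha> A \<le> ennreal 144 * (gr_norm \<alpha> A + X)"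
proof (cases "gr_norm \<alpha> A + X")
  case (real K)
  then have "gr_norm \<alpha> A \<le> ennreal K" "X \<le> ennreal K"
    by (metis le_iff_add add.commute)+
  then show ?thesis
    using gr_imp_growth[of K] X[of K] growth_three_point_imp_hol[of K] real
    by (simp add: ennreal_mult)
next
  case top
  show ?thesis unfolding top by (simp add: ennreal_mult_top)
qed

lemma gr_plus_le_hol:
  assumes X: "\<And>K. three_point K \<Longrightarrow> X \<le> ennreal (144000 * K)"
  shows "gr_norm \<alpha> A + X \<le> ennreal 2000000 * hol_norm \<alpha> A"
proof (cases "hol_norm \<alpha> A")
  case (real K)
  have "gr_norm \<alpha> A \<le> ennreal K"
    using real by (intro growth_imp_gr hol_imp_growth) simp_all
  moreover have "X \<le> ennreal (144000 * (9 * K))"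
    using real by (intro X hol_imp_three_point) simp_all
  ultimately have "gr_norm \<alpha> A + X \<le> ennreal K + ennreal (144000 * (9 * K))" by (rule add_mono)
  also have "\<dots> = ennreal (1296001 * K)" using real by (simp flip: ennreal_plus)
  also have "\<dots> \<le> ennreal (2000000 * K)" using real by (intro ennreal_leI) simp
  finally show ?thesis using real by (simp add: ennreal_mult)
next
  case top
  then show ?thesis by (simp add: ennreal_mult_top)
qed

text \<open>The constants to cover are 144 in one direction and 1 + 9 * 144000 = 1296001 in the
  other.\<close>

lemma norm_equivalence:
  assumes "\<And>K. growth K \<Longrightarrow> X \<le> ennreal K \<Longrightarrow> three_point (18 * K)"
    and "\<And>K. three_point K \<Longrightarrow> X \<le> ennreal (144000 * K)"
  shows "ennreal (1 / 2000000) * hol_norm \<alpha> A \<le> gr_norm \<alpha> A + X \<and>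
    gr_norm \<alpha> A + X \<le> ennreal 2000000 * hol_norm \<alpha> A"
proof
  have "ennreal (1 / 2000000) * hol_norm \<alpha> A \<le>
      ennreal (1 / 2000000) * (ennreal 144 * (gr_norm \<alpha> A + X))"
    by (intro mult_left_mono hol_le_gr_plus assms(1) zero_le)
  also have "\<dots> = ennreal (144 / 2000000) * (gr_norm \<alpha> A + X)"
    using ennreal_mult[of "1 / 2000000" 144] by (simp only: mult.assoc[symmetric]) simp
  also have "\<dots> \<le> 1 * (gr_norm \<alpha> A + X)" by (intro mult_right_mono) (simp_all add: ennreal_le_1)
  finally show "ennreal (1 / 2000000) * hol_norm \<alpha> A \<le> gr_norm \<alpha> A + X" by simp
qed (rule gr_plus_le_hol, rule assms(2))

lemma norm_equivalences:
  "ennreal (1 / 2000000) * hol_norm \<alpha> A \<le> gr_norm \<alpha> A + vee_norm \<alpha> A \<and>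
    gr_norm \<alpha> A + vee_norm \<alpha> A \<le> ennreal 2000000 * hol_norm \<alpha> A"
  "ennreal (1 / 2000000) * hol_norm \<alpha> A \<le> gr_norm \<alpha> A + tri_norm \<alpha> A \<and>
    gr_norm \<alpha> A + tri_norm \<alpha> A \<le> ennreal 2000000 * hol_norm \<alpha> A"
  "ennreal (1 / 2000000) * hol_norm \<alpha> A \<le> gr_norm \<alpha> A + symm_norm \<alpha> A \<and>
    gr_norm \<alpha> A + symm_norm \<alpha> A \<le> ennreal 2000000 * hol_norm \<alpha> A"
proof -
  have up: "X \<le> ennreal (144000 * K)"
    if "three_point K" "X \<le> ennreal (c * K)" "c \<le> 144000" for X :: ennreal and c K
    using that by (auto intro!: ennreal_leI mult_right_mono elim!: order_trans simp: three_point_def)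
  have up': "three_point (18 * K)" if "growth K" "three_point (9 * K)" for K
    using that by (intro three_point_mono[OF that(2)]) (simp add: growth_def)
  show "ennreal (1 / 2000000) * hol_norm \<alpha> A \<le> gr_norm \<alpha> A + vee_norm \<alpha> A \<and>
    gr_norm \<alpha> A + vee_norm \<alpha> A \<le> ennreal 2000000 * hol_norm \<alpha> A"
    by (intro norm_equivalence vee_imp_three_point up[OF _ three_point_imp_vee]) simp_all
  show "ennreal (1 / 2000000) * hol_norm \<alpha> A \<le> gr_norm \<alpha> A + tri_norm \<alpha> A \<and>
    gr_norm \<alpha> A + tri_norm \<alpha> A \<le> ennreal 2000000 * hol_norm \<alpha> A"
    by (intro norm_equivalence up'[OF _ tri_imp_three_point] up[OF _ three_point_imp_tri]) simp_all
  show "ennreal (1 / 2000000) * hol_norm \<alpha> A \<le> gr_norm \<alpha> A + symm_norm \<alpha> A \<and>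
    gr_norm \<alpha> A + symm_norm \<alpha> A \<le> ennreal 2000000 * hol_norm \<alpha> A"
    by (intro norm_equivalence up'[OF _ symm_imp_three_point] three_point_imp_symm)
qed

end

theorem theorem3p11:
  "\<exists>C::real. C \<ge> 1 \<and> (\<forall>\<alpha>::real \<in> {0..1}. \<forall>A :: seg \<Rightarrow> 'e::banach. A \<in> Omega \<longrightarrow>
     (ennreal (1 / C) * hol_norm \<alpha> A \<le> gr_norm \<alpha> A + vee_norm \<alpha> A \<and>
      gr_norm \<alpha> A + vee_norm \<alpha> A \<le> ennreal C * hol_norm \<alpha> A) \<and>
     (ennreal (1 / C) * hol_norm \<alpha> A \<le> gr_norm \<alpha> A + tri_norm \<alpha> A \<and>
      gr_norm \<alpha> A + tri_norm \<alpha> A \<le> ennreal C * hol_norm \<alpha> A) \<and>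
     (ennreal (1 / C) * hol_norm \<alpha> A \<le> gr_norm \<alpha> A + symm_norm \<alpha> A \<and>
      gr_norm \<alpha> A + symm_norm \<alpha> A \<le> ennreal C * hol_norm \<alpha> A))"
proof (intro exI[of _ 2000000] conjI[of "1 \<le> 2000000"] ballI allI impI)
  fix \<alpha> :: real and A :: "seg \<Rightarrow> 'e"
  assume "\<alpha> \<in> {0..1}" "A \<in> Omega"
  then interpret additive_functional A \<alpha> by unfold_locales auto
  show "(ennreal (1 / 2000000) * hol_norm \<alpha> A \<le> gr_norm \<alpha> A + vee_norm \<alpha> A \<and>
      gr_norm \<alpha> A + vee_norm \<alpha> A \<le> ennreal 2000000 * hol_norm \<alpha> A) \<and>
     (ennreal (1 / 2000000) * hol_norm \<alpha> A \<le> gr_norm \<alpha> A + tri_norm \<alpha> A \<and>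
      gr_norm \<alpha> A + tri_norm \<alpha> A \<le> ennreal 2000000 * hol_norm \<alpha> A) \<and>
     (ennreal (1 / 2000000) * hol_norm \<alpha> A \<le> gr_norm \<alpha> A + symm_norm \<alpha> A \<and>
      gr_norm \<alpha> A + symm_norm \<alpha> A \<le> ennreal 2000000 * hol_norm \<alpha> A)"
    using norm_equivalences by (intro conjI) simp_all
qed simp

end
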